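(* Let $d=d(n)$ be integers with $dn$ even and $\min\{d,n-d\}\gg n/\sqrt{\log n}$. Then there are probabilities $p_1=(1-o(1))d/n$ and $p_2=(1+o(1))d/n$ and a coupling $(G^L,G,G^U)$ such that $G^L\sim\mathcal{G}(n,p_1)$, $G^U\sim\mathcal{G}(n,p_2)$, $G\sim\mathcal{G}(n,d)$ and $\mathbb{P}(G^L\subseteq G\subseteq G^U)=1-o(1)$.
   Context: All asymptotics are as $n\to\infty$; $a_n\gg b_n$ means $b_n/a_n\to0$ with both positive. $\mathcal{G}(n,p)$ is the binomial random graph on $[n]$ with each edge present independently with probability $p$. $\mathcal{G}(n,d)$ is the uniformly random $d$-regular simple graph on $[n]$. A coupling of random graphs is a random tuple whose marginals have the given distributions; graph containment refers to edge sets. *)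

theory Defs
  imports "HOL-Probability.Probability" "HOL-Probability.Product_PMF"
begin

text \<open>A simple graph on the vertex set \<open>{1..n}\<close> is represented by its edge set, a set of
  two-element subsets of \<open>{1..n}\<close>, so that graph containment is inclusion of sets.\<close>

type_synonym graph = "nat set set"

definition complete_edges :: "nat \<Rightarrow> graph" where
  "complete_edges n = {e. e \<subseteq> {1..n} \<and> card e = 2}"

definition degree :: "graph \<Rightarrow> nat \<Rightarrow> nat" where
  "degree E v = card {e \<in> E. v \<in> e}"

definition regular_graphs :: "nat \<Rightarrow> nat \<Rightarrow> graph set" where
  "regular_graphs n d = {E. E \<subseteq> complete_edges n \<and> (\<forall>v\<in>{1..n}. degree E v = d)}"

definition binomial_graph :: "nat \<Rightarrow> real \<Rightarrow> graph pmf" where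
  "binomial_graph n p =
     map_pmf (\<lambda>f. {e \<in> complete_edges n. f e})
       (Pi_pmf (complete_edges n) False (\<lambda>_. bernoulli_pmf p))"

text \<open>Only meaningful when \<open>regular_graphs n d\<close> is nonempty, which for \<open>n \<ge> 1\<close> holds exactly
  if \<open>d < n\<close> and \<open>d * n\<close> is even; otherwise it is an unspecified distribution.\<close>

definition regular_graph :: "nat \<Rightarrow> nat \<Rightarrow> graph pmf" where
  "regular_graph n d = pmf_of_set (regular_graphs n d)"

text \<open>The joint law of a random triple with the given marginal laws.\<close>

definition coupling3 :: "('a \<times> 'b \<times> 'c) pmf \<Rightarrow> 'a pmf \<Rightarrow> 'b pmf \<Rightarrow> 'c pmf \<Rightarrow> bool" where
  "coupling3 \<Gamma> A B C \<longleftrightarrow>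
     map_pmf (\<lambda>(x, y, z). x) \<Gamma> = A \<and>
     map_pmf (\<lambda>(x, y, z). y) \<Gamma> = B \<and>
     map_pmf (\<lambda>(x, y, z). z) \<Gamma> = C"

text \<open>\<open>much_greater a b\<close> is \<open>a\<^sub>n \<gg> b\<^sub>n\<close>. Positivity is only asked of all large \<open>n\<close>, as
  sequences such as \<open>n / sqrt (ln n)\<close> are not proper for small \<open>n\<close>.\<close>

definition much_greater :: "(nat \<Rightarrow> real) \<Rightarrow> (nat \<Rightarrow> real) \<Rightarrow> bool" where
  "much_greater a b \<longleftrightarrow>
     (\<forall>\<^sub>F n in sequentially. 0 < a n \<and> 0 < b n) \<and> (\<lambda>n. b n / a n) \<longlonglongrightarrow> 0"

end

theory Submission
  imports Defs "HOL-Real_Asymp.Real_Asymp"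
begin

text \<open>
  Write \<open>q = d / (n - 1)\<close> and let \<open>H\<close> retain each edge of the random regular graph \<open>G\<close> independently
  with probability \<open>1 - \<xi>\<close>. If, for every pair \<open>e\<close>, the probability of \<open>e \<in> H\<close> given \<open>H - {e}\<close> is
  at least \<open>p\<close> outside an event of tiny probability, then revealing \<open>H\<close> pair by pair embeds
  \<open>G(n,p)\<close> into \<open>H \<subseteq> G\<close>. By Bayes this conditional probability is governed by the ratio of the
  numbers of regular graphs above \<open>H\<close> with and without \<open>e = uv\<close>, which is estimated by the switching
  that replaces \<open>ux, vy\<close> by \<open>uv, xy\<close>. The two switching counts are \<open>e(N\<^sub>S(u), N\<^sub>S(v))\<close> in the complement
  of \<open>G\<close> and the number of edges of \<open>S = G - H\<close> between the non-neighbourhoods of \<open>u\<close> and \<open>v\<close>, so the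
  only pseudorandomness needed is an upper bound on \<open>e\<^sub>G(A, B)\<close> for all vertex sets \<open>A\<close>, \<open>B\<close>.

  That bound fails for a graph with \<open>dn/2\<close> uniformly random edges with probability only
  \<open>exp (- n\<^sup>2 / polylog n)\<close>. It passes to regular graphs because these are not too rare: moving an edge
  \<open>uw\<close> to \<open>vw\<close>, where \<open>deg u > d > deg v\<close>, lowers the total excess degree, and a typical graph has
  excess at most \<open>n powr (7/4)\<close>, so regular graphs are at least a proportion
  \<open>exp (- O(n powr (7/4) * ln n))\<close> of all graphs with \<open>dn/2\<close> edges.

  With \<open>\<xi> = 1 / ln n\<close> this gives \<open>p\<^sub>1 = (1 - 2 * \<xi>) * q\<close>. The upper graph is the complement of the lower
  graph for degree \<open>n - 1 - d\<close>; there \<open>p\<^sub>2 = q + 2 * \<xi> * (1 - q)\<close>, and \<open>\<xi> = o(q)\<close> by the assumption on \<open>d\<close>.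
\<close>

section \<open>Random subsets and couplings\<close>

text \<open>The construction of \<open>binomial_graph\<close> over an arbitrary ground set:
  subgraphs of a fixed regular graph are sampled in the same way, and the ground set shrinks in the
  induction of \<open>dominating_coupling\<close>.\<close>

definition random_subset :: "'a set \<Rightarrow> real \<Rightarrow> 'a set pmf" where
  "random_subset E p =
     map_pmf (\<lambda>f. {e \<in> E. f e}) (Pi_pmf E False (\<lambda>_. bernoulli_pmf p))"

lemma binomial_graph_eq_random_subset:
  "binomial_graph n p = random_subset (complete_edges n) p"
  by (simp add: binomial_graph_def random_subset_def)

lemma random_subset_empty [simp]: "random_subset {} p = return_pmf {}"
  by (simp add: random_subset_def)

lemma random_subset_insert:
  assumes "finite E" "e \<notin> E"
  shows "random_subset (insert e E) p =
    do {b \<leftarrow> bernoulli_pmf p; Y \<leftarrow> random_subset E p; return_pmf (if b then insert e Y else Y)}"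
proof -
  have "{x \<in> insert e E. (f(e := y)) x} = (if y then insert e {x \<in> E. f x} else {x \<in> E. f x})"
    for f y using assms by auto
  then show ?thesis
    unfolding random_subset_def Pi_pmf_insert'[OF assms]
    by (simp add: map_pmf_def bind_assoc_pmf bind_return_pmf del: fun_upd_apply)
qed

lemma set_pmf_random_subset: "finite E \<Longrightarrow> set_pmf (random_subset E p) \<subseteq> Pow E"
  by (auto simp: random_subset_def)

lemma pmf_random_subset:
  assumes "finite E" "h \<subseteq> E" "0 \<le> p" "p \<le> 1"
  shows "pmf (random_subset E p) h = p ^ card h * (1 - p) ^ card (E - h)"
proof -
  let ?P = "Pi_pmf E False (\<lambda>_. bernoulli_pmf p)"
  have "pmf (random_subset E p) h = measure ?P ((\<lambda>f. {e \<in> E. f e}) -` {h})"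
    by (simp add: random_subset_def pmf_map)
  also have "\<dots> = measure ?P {\<lambda>e. e \<in> h}"
  proof (rule measure_pmf.finite_measure_eq_AE)
    \<comment> \<open>Functions in the support are \<open>False\<close> outside \<open>E\<close>, so
      the selected set determines the function.\<close>
    show "AE x in measure_pmf ?P. (x \<in> (\<lambda>f. {e \<in> E. f e}) -` {h}) = (x \<in> {\<lambda>e. e \<in> h})"
      using set_Pi_pmf_subset[OF assms(1), of False "\<lambda>_. bernoulli_pmf p"] assms(2)
      by (auto simp: AE_measure_pmf_iff fun_eq_iff)
  qed auto
  also have "\<dots> = (\<Prod>e\<in>E. pmf (bernoulli_pmf p) (e \<in> h))"
    using assms by (subst pmf_Pi'[symmetric, where dflt = False]) (auto simp: pmf.rep_eq)
  also have "\<dots> = (\<Prod>e\<in>E. if e \<in> h then p else 1 - p)"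
    using assms by (intro prod.cong) auto
  also have "\<dots> = p ^ card (E \<inter> h) * (1 - p) ^ card (E - h)"
    using assms(1) by (simp add: prod.If_cases Collect_mem_eq Diff_eq Compl_eq)
  also have "E \<inter> h = h" using assms by auto
  finally show ?thesis .
qed

text \<open>Serves two passages: from retained to removed edges of a regular graph, and from a lower
  graph to an upper graph for the complementary degree.\<close>

lemma random_subset_complement:
  assumes "finite E" "0 \<le> p" "p \<le> 1"
  shows "map_pmf (\<lambda>h. E - h) (random_subset E p) = random_subset E (1 - p)"
proof (rule pmf_eqI)
  fix h
  show "pmf (map_pmf (\<lambda>h. E - h) (random_subset E p)) h = pmf (random_subset E (1 - p)) h"
  proof (cases "h \<subseteq> E")
    case True
    have "pmf (map_pmf (\<lambda>h. E - h) (random_subset E p)) h =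
        measure (random_subset E p) ((\<lambda>h. E - h) -` {h})"
      by (simp add: pmf_map)
    also have "\<dots> = measure (random_subset E p) {E - h}"
    proof (rule measure_pmf.finite_measure_eq_AE)
      show "AE x in random_subset E p. (x \<in> (\<lambda>h. E - h) -` {h}) = (x \<in> {E - h})"
        using set_pmf_random_subset[OF assms(1), of p] True by (auto simp: AE_measure_pmf_iff)
    qed auto
    also have "\<dots> = pmf (random_subset E p) (E - h)"
      by (simp add: pmf.rep_eq)
    also have "\<dots> = pmf (random_subset E (1 - p)) h"
      using assms True by (simp add: pmf_random_subset double_diff)
    finally show ?thesis .
  next
    case False
    then have "h \<notin> set_pmf (map_pmf (\<lambda>h. E - h) (random_subset E p))"
      "h \<notin> set_pmf (random_subset E (1 - p))"
      using set_pmf_random_subset[OF assms(1)] by auto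
    then show ?thesis by (metis pmf_eq_0_set_pmf)
  qed
qed

section \<open>Exponential moments and the Chernoff bound for random subsets\<close>

lemma sum_pow_card:
  fixes x :: real
  assumes "finite F"
  shows "(\<Sum>K\<in>Pow F. x ^ card K) = (1 + x) ^ card F"
  using prod_add[OF assms, of "\<lambda>_. x" "\<lambda>_. 1"] by (simp add: add.commute)

text \<open>The power is a product of independent factors, one for each element of \<open>E\<close>;
  those outside \<open>F\<close> have mean 1, the others \<open>1 + x * p\<close>.\<close>

lemma expectation_random_subset_pow_card:
  assumes "finite E" "0 \<le> p" "p \<le> 1" "0 \<le> x"
  shows "measure_pmf.expectation (random_subset E p) (\<lambda>h. (1 + x) ^ card (h \<inter> F)) =
    (1 + x * p) ^ card (E \<inter> F)"
proof -
  let ?P = "Pi_pmf E False (\<lambda>_. bernoulli_pmf p)"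
  let ?g = "\<lambda>e b. if b \<and> e \<in> F then 1 + x else 1"
  have "(1 + x) ^ card ({e \<in> E. f e} \<inter> F) = (\<Prod>e\<in>E. ?g e (f e))" for f
  proof -
    have "(\<Prod>e\<in>E. ?g e (f e)) = (1 + x) ^ card (E \<inter> {e. f e \<and> e \<in> F})"
      using assms(1) by (simp add: prod.If_cases)
    also have "E \<inter> {e. f e \<and> e \<in> F} = {e \<in> E. f e} \<inter> F" by auto
    finally show ?thesis by simp
  qed
  then have "measure_pmf.expectation (random_subset E p) (\<lambda>h. (1 + x) ^ card (h \<inter> F)) =
      measure_pmf.expectation ?P (\<lambda>f. \<Prod>e\<in>E. ?g e (f e))"
    by (simp add: random_subset_def)
  also have "\<dots> = (\<Prod>e\<in>E. measure_pmf.expectation (bernoulli_pmf p) (?g e))"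
    using assms by (intro expectation_prod_Pi_pmf integrable_measure_pmf_finite) auto
  also have "\<dots> = (\<Prod>e\<in>E. if e \<in> F then 1 + x * p else 1)"
    using assms by (intro prod.cong) (auto simp: algebra_simps)
  also have "\<dots> = (1 + x * p) ^ card (E \<inter> F)"
    using assms(1) by (simp add: prod.If_cases)
  finally show ?thesis .
qed

text \<open>The deterministic half of a Chernoff bound, shared by the independent model and the
  fixed-size model. It combines \<open>1 + x * q \<le> exp (x * q)\<close> with
  \<open>ln (1 + x) \<ge> x - x\<^sup>2\<close>; the choice \<open>x = \<tau> / (2 * L)\<close>
  maximises the gain \<open>\<tau> * x - L * x\<^sup>2\<close>, whose value is then
  \<open>\<tau>\<^sup>2 / (4 * L)\<close>.\<close>

lemma chernoff_pointwise:
  fixes X m :: nat and q \<tau> L :: real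
  assumes "X \<le> m" "real m \<le> L" "0 < L" "0 \<le> q" "0 \<le> \<tau>" "q * real m + \<tau> \<le> real X"
  shows "exp (\<tau>\<^sup>2 / (4 * L)) * (1 + \<tau> / (2 * L) * q) ^ m \<le> (1 + \<tau> / (2 * L)) ^ X"
proof -
  define x where "x = \<tau> / (2 * L)"
  have "0 \<le> q * real m" using assms by auto
  \<comment> \<open>From \<open>q * m + \<tau> \<le> X \<le> m \<le> L\<close>; it yields
    \<open>x \<le> 1\<close>, which the bound on the logarithm requires.\<close>
  then have "\<tau> \<le> L" using assms by linarith
  then have x: "0 \<le> x" "x \<le> 1" using assms by (auto simp: x_def divide_simps)
  have "(1 + x * q) ^ m \<le> exp (x * q) ^ m"
    using x assms by (intro power_mono) auto
  then have "exp (\<tau>\<^sup>2 / (4 * L)) * (1 + x * q) ^ m \<le> exp (\<tau>\<^sup>2 / (4 * L)) * exp (x * q) ^ m"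
    by simp
  also have "\<dots> = exp (\<tau>\<^sup>2 / (4 * L) + real m * (x * q))"
    by (simp add: exp_of_nat_mult exp_add)
  also have "\<dots> \<le> exp (real X * (x - x\<^sup>2))"
  proof -
    have "\<tau>\<^sup>2 / (4 * L) = \<tau> * x - L * x\<^sup>2"
      using assms by (simp add: x_def field_simps power2_eq_square)
    also have "\<dots> \<le> (real X - q * real m) * x - real X * x\<^sup>2"
      using assms x by (intro diff_mono mult_right_mono) auto
    finally show ?thesis by (simp add: algebra_simps)
  qed
  also have "\<dots> \<le> exp (real X * ln (1 + x))"
    using ln_one_plus_pos_lower_bound[OF x] by (auto intro: mult_left_mono)
  also have "\<dots> = (1 + x) ^ X"
    using x by (simp add: exp_of_nat_mult)
  finally show ?thesis by (simp add: x_def)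
qed

text \<open>Markov's inequality for \<open>(1 + x) ^ card (h \<inter> F)\<close>. As
  \<open>L\<close> may be any upper bound for \<open>card (E \<inter> F)\<close>, one exponent
  serves all stars, or all pairs of vertex sets.\<close>

lemma prob_random_subset_upper_tail:
  assumes "finite E" "0 \<le> p" "p \<le> 1" "0 < L" "real (card (E \<inter> F)) \<le> L" "0 \<le> \<tau>"
  shows "measure_pmf.prob (random_subset E p)
      {h. real (card (h \<inter> F)) > p * real (card (E \<inter> F)) + \<tau>} \<le> exp (- (\<tau>\<^sup>2 / (4 * L)))"
proof -
  define x where "x = \<tau> / (2 * L)"
  have x: "0 \<le> x" using assms by (simp add: x_def)
  define c where "c = exp (\<tau>\<^sup>2 / (4 * L)) * (1 + x * p) ^ card (E \<inter> F)"
  have c: "c > 0" using x assms by (auto simp: c_def add_pos_nonneg)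
  have "measure_pmf.prob (random_subset E p)
      {h. real (card (h \<inter> F)) > p * real (card (E \<inter> F)) + \<tau>}
    \<le> measure_pmf.prob (random_subset E p) {h. c \<le> (1 + x) ^ card (h \<inter> F)}"
  proof (rule measure_pmf.finite_measure_mono_AE)
    show "AE h in random_subset E p. h \<in> {h. real (card (h \<inter> F)) > p * real (card (E \<inter> F)) + \<tau>}
      \<longrightarrow> h \<in> {h. c \<le> (1 + x) ^ card (h \<inter> F)}"
    proof (clarsimp simp: AE_measure_pmf_iff)
      fix h assume h: "h \<in> set_pmf (random_subset E p)"
        "p * real (card (E \<inter> F)) + \<tau> < real (card (h \<inter> F))"
      then have "h \<subseteq> E" using set_pmf_random_subset[OF assms(1)] by blast
      then have "card (h \<inter> F) \<le> card (E \<inter> F)" using assms(1) by (intro card_mono) auto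
      from chernoff_pointwise[OF this, of L p \<tau>] h assms
      show "c \<le> (1 + x) ^ card (h \<inter> F)" by (simp add: c_def x_def)
    qed
  qed auto
  also have "\<dots> \<le> measure_pmf.expectation (random_subset E p) (\<lambda>h. (1 + x) ^ card (h \<inter> F)) / c"
  proof -
    have "measure (random_subset E p) {h \<in> space (random_subset E p). c \<le> (1 + x) ^ card (h \<inter> F)} \<le>
        measure_pmf.expectation (random_subset E p) (\<lambda>h. (1 + x) ^ card (h \<inter> F)) / c"
    proof (intro integral_Markov_inequality_measure[where A = "{}"] c)
      show "integrable (random_subset E p) (\<lambda>h. (1 + x) ^ card (h \<inter> F))"
        by (rule integrable_measure_pmf_finite)
          (use finite_subset[OF set_pmf_random_subset[OF assms(1)]] assms(1) in auto)
    qed (use x in auto)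
    then show ?thesis by simp
  qed
  also have "\<dots> = exp (- (\<tau>\<^sup>2 / (4 * L)))"
  proof -
    have "1 + x * p > 0" using x assms by (auto simp: add_pos_nonneg)
    then show ?thesis
      unfolding expectation_random_subset_pow_card[OF assms(1-3) x, of F] c_def
      by (auto simp: exp_minus inverse_eq_divide)
  qed
  finally show ?thesis .
qed

section \<open>Gluing of couplings and stochastic domination\<close>

text \<open>Given the pair from \<open>P\<close>, the third coordinate is drawn from
  \<open>Q\<close> conditioned on the shared coordinate.\<close>

lemma glue_couplings:
  fixes P :: "('a \<times> 'b) pmf" and Q :: "('b \<times> 'c) pmf"
  assumes "map_pmf snd P = map_pmf fst Q"
  obtains T :: "('a \<times> 'b \<times> 'c) pmf"
  where "map_pmf (\<lambda>(a, b, c). (a, b)) T = P" "map_pmf (\<lambda>(a, b, c). (b, c)) T = Q"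
proof -
  let ?C = "\<lambda>w. cond_pmf Q {z. snd w = fst z}"
  define T where "T = bind_pmf P (\<lambda>w. map_pmf (\<lambda>z. (fst w, z)) (?C w))"
  have ne: "set_pmf Q \<inter> {z. snd w = fst z} \<noteq> {}" if "w \<in> set_pmf P" for w
  proof -
    have "snd w \<in> set_pmf (map_pmf snd P)" using that by auto
    then show ?thesis unfolding assms by auto
  qed
  have ne': "set_pmf P \<inter> {w. snd w = fst z} \<noteq> {}" if "z \<in> set_pmf Q" for z
  proof -
    have "fst z \<in> set_pmf (map_pmf fst Q)" using that by auto
    then show ?thesis unfolding assms[symmetric] by auto
  qed
  have meas: "measure Q {z. b = fst z} = measure P {w. snd w = b}" for b
    using arg_cong[OF assms, of "\<lambda>\<mu>. pmf \<mu> b"] by (simp add: pmf_map vimage_def eq_commute)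
  have "map_pmf (\<lambda>(a, b, c). (a, b)) T = bind_pmf P (\<lambda>w. map_pmf (\<lambda>z. (fst w, fst z)) (?C w))"
    by (simp add: T_def map_bind_pmf map_pmf_comp case_prod_beta)
  also have "\<dots> = bind_pmf P return_pmf"
  proof (rule bind_pmf_cong[OF refl])
    fix w assume w: "w \<in> set_pmf P"
    have "map_pmf (\<lambda>z. (fst w, fst z)) (?C w) = map_pmf (\<lambda>z. w) (?C w)"
      using ne[OF w] by (intro map_pmf_cong) auto
    then show "map_pmf (\<lambda>z. (fst w, fst z)) (?C w) = return_pmf w" by simp
  qed
  finally have 1: "map_pmf (\<lambda>(a, b, c). (a, b)) T = P" by (simp add: bind_return_pmf')
  have "map_pmf (\<lambda>(a, b, c). (b, c)) T = bind_pmf P ?C"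
    by (simp add: T_def map_bind_pmf map_pmf_comp case_prod_beta)
  also have "\<dots> = Q"
    using ne ne' meas by (intro bind_cond_pmf_cancel) auto
  finally show ?thesis using 1 that by blast
qed

text \<open>The less likely event is obtained by thinning the more likely one, so the first occurs
  without the second only if \<open>p > q\<close>, and then with probability exactly
  \<open>p - q\<close>.\<close>

lemma bernoulli_coupling:
  fixes p q :: real
  assumes "0 \<le> p" "p \<le> 1" "0 \<le> q" "q \<le> 1"
  obtains T :: "(bool \<times> bool) pmf"
  where "map_pmf fst T = bernoulli_pmf p" "map_pmf snd T = bernoulli_pmf q"
    "measure_pmf.prob T {z. fst z \<and> \<not> snd z} = max 0 (p - q)"
proof -
  have "\<exists>T. map_pmf fst T = bernoulli_pmf a \<and> map_pmf snd T = bernoulli_pmf b \<and>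
      measure_pmf.prob T {z. fst z \<and> \<not> snd z} = 0 \<and>
      measure_pmf.prob T {z. snd z \<and> \<not> fst z} = b - a"
    if ab: "0 \<le> a" "a \<le> b" "b \<le> 1" for a b :: real
  proof -
    \<comment> \<open>If \<open>b = 0\<close>, then \<open>a = 0\<close> and the quotient is 0 by
      convention, so \<open>b * r = a\<close> still holds.\<close>
    define r where "r = a / b"
    have r: "0 \<le> r" "r \<le> 1" using ab by (auto simp: r_def divide_le_eq_1)
    have br: "b * r = a" using ab by (cases "b = 0") (auto simp: r_def)
    define T where "T = map_pmf (\<lambda>(s, t). (s \<and> t, s)) (pair_pmf (bernoulli_pmf b) (bernoulli_pmf r))"
    have "map_pmf (\<lambda>z. fst z \<and> snd z) (pair_pmf (bernoulli_pmf b) (bernoulli_pmf r)) = bernoulli_pmf a"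
    proof (rule pmf_eqI)
      fix i
      let ?Q = "pair_pmf (bernoulli_pmf b) (bernoulli_pmf r)"
      have "(\<lambda>z. fst z \<and> snd z) -` {True} = {(True, True)}" by force
      then have "pmf (map_pmf (\<lambda>z. fst z \<and> snd z) ?Q) True = pmf ?Q (True, True)"
        by (simp only: pmf_map measure_pmf_single)
      also have "\<dots> = a"
        using r ab by (simp add: pmf_pair br)
      finally have *: "pmf (map_pmf (\<lambda>z. fst z \<and> snd z) ?Q) True = a" .
      have F: "pmf (map_pmf (\<lambda>z. fst z \<and> snd z) ?Q) False = 1 - a"
        by (subst pmf_False_conv_True) (simp only: *)
      show "pmf (map_pmf (\<lambda>z. fst z \<and> snd z) (pair_pmf (bernoulli_pmf b) (bernoulli_pmf r))) i
        = pmf (bernoulli_pmf a) i"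
        by (cases i) (use ab in \<open>simp_all only: * F pmf_bernoulli_True pmf_bernoulli_False\<close>)
    qed
    then have 1: "map_pmf fst T = bernoulli_pmf a"
      by (simp add: T_def map_pmf_comp case_prod_beta)
    have 2: "map_pmf snd T = bernoulli_pmf b"
      by (simp add: T_def map_pmf_comp case_prod_beta map_fst_pair_pmf)
    have 3: "measure_pmf.prob T {z. fst z \<and> \<not> snd z} = 0"
      by (auto simp: T_def measure_pmf_zero_iff)
    have "(\<lambda>(s, t). (s \<and> t, s)) -` {z. snd z \<and> \<not> fst z} = {(True, False)}" by force
    then have 4: "measure_pmf.prob T {z. snd z \<and> \<not> fst z} = b - a"
      using r ab by (simp add: T_def measure_pmf_single pmf_pair right_diff_distrib br)
    from 1 2 3 4 show ?thesis by blast
  qed note * = this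
  show ?thesis
  proof (cases "p \<le> q")
    case True
    obtain T where T: "map_pmf fst T = bernoulli_pmf p" "map_pmf snd T = bernoulli_pmf q"
      "measure_pmf.prob T {z. fst z \<and> \<not> snd z} = 0"
      using *[OF assms(1) True assms(4)] by blast
    show ?thesis by (rule that[OF T(1,2)]) (use True T(3) in simp)
  next
    case False
    then obtain T where T: "map_pmf fst T = bernoulli_pmf q" "map_pmf snd T = bernoulli_pmf p"
      "measure_pmf.prob T {z. snd z \<and> \<not> fst z} = p - q"
      using *[of q p] assms by (meson linear)
    show ?thesis
    proof (rule that[of "map_pmf prod.swap T"])
      show "measure_pmf.prob (map_pmf prod.swap T) {z. fst z \<and> \<not> snd z} = max 0 (p - q)"
        using T(3) False by (simp add: vimage_def)
    qed (use T in \<open>simp_all add: map_pmf_comp\<close>)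
  qed
qed

lemma prob_bind_pmf:
  fixes f :: "'a \<Rightarrow> 'b pmf"
  shows "measure_pmf.prob (bind_pmf M f) S = (\<integral>x. measure_pmf.prob (f x) S \<partial>measure_pmf M)"
proof -
  have *: "measure_pmf.prob N S = pmf (map_pmf (\<lambda>z. z \<in> S) N) True" for N :: "'b pmf"
    by (simp add: pmf_map vimage_def)
  show ?thesis by (simp only: * map_bind_pmf pmf_bind)
qed

lemma pmf_map_remove:
  assumes "e \<notin> h"
  shows "pmf (map_pmf (\<lambda>X. X - {e}) \<mu>) h = pmf \<mu> h + pmf \<mu> (insert e h)"
proof -
  have "(\<lambda>X. X - {e}) -` {h} = {h, insert e h}" using assms by auto
  moreover have "h \<noteq> insert e h" using assms by blast
  ultimately show ?thesis by (simp add: pmf_map measure_measure_pmf_finite)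
qed

text \<open>\<open>q X\<close> is the conditional probability of \<open>e\<close> given the
  remaining elements, so adding \<open>e\<close> afresh with this probability restores the
  law.\<close>

lemma resample_element:
  fixes \<mu> :: "'a set pmf" and e :: 'a
  defines "\<nu> \<equiv> map_pmf (\<lambda>X. X - {e}) \<mu>"
  defines "q \<equiv> \<lambda>X. pmf \<mu> (insert e X) / pmf \<nu> X"
  shows "bind_pmf \<nu> (\<lambda>X. map_pmf (\<lambda>b. if b then insert e X else X) (bernoulli_pmf (q X))) = \<mu>"
proof (rule pmf_eqI)
  fix i
  define h where "h = i - {e}"
  have e: "e \<notin> h" by (simp add: h_def)
  let ?K = "\<lambda>X. map_pmf (\<lambda>b. if b then insert e X else X) (bernoulli_pmf (q X))"
  have nu: "pmf \<nu> h = pmf \<mu> h + pmf \<mu> (insert e h)"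
    unfolding \<nu>_def by (rule pmf_map_remove[OF e])
  have q: "0 \<le> q h" "q h \<le> 1"
    unfolding q_def nu by (simp_all add: pmf_nonneg divide_le_eq_1)
      (use pmf_nonneg[of \<mu> h] pmf_nonneg[of \<mu> "insert e h"] in linarith)
  have "pmf (bind_pmf \<nu> ?K) i = (\<integral>X. pmf (?K X) i \<partial>\<nu>)" by (rule pmf_bind)
  also have "\<dots> = (\<Sum>X\<in>{h}. pmf (?K X) i * pmf \<nu> X)"
  proof (rule integral_measure_pmf_real)
    fix X assume X: "X \<in> set_pmf \<nu>" "pmf (?K X) i \<noteq> 0"
    from X(1) have "e \<notin> X" by (auto simp: \<nu>_def)
    moreover have "i \<in> set_pmf (?K X)" using X(2) by (simp only: set_pmf_iff not_False_eq_True)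
    ultimately show "X \<in> {h}" by (auto simp: h_def split: if_splits)
  qed auto
  also have "\<dots> = pmf (?K h) i * pmf \<nu> h" by simp
  also have "pmf (?K h) i = (if e \<in> i then q h else 1 - q h)"
  proof -
    have "(\<lambda>b. if b then insert e h else h) -` {i} = {e \<in> i}"
      using e by (auto simp: h_def vimage_def split: if_splits)
    then show ?thesis using q by (simp add: pmf_map measure_pmf_single)
  qed
  also have "(if e \<in> i then q h else 1 - q h) * pmf \<nu> h = pmf \<mu> i"
  proof -
    \<comment> \<open>Where \<nu> has mass 0 the quotient takes the default value 0; the claim holds
      because both masses of \<mu> then vanish.\<close>
    have *: "q h * pmf \<nu> h = pmf \<mu> (insert e h)"
      using pmf_nonneg[of \<mu> h] pmf_nonneg[of \<mu> "insert e h"] nu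
      by (cases "pmf \<nu> h = 0") (simp_all add: q_def add_nonneg_eq_0_iff)
    have "insert e h = (if e \<in> i then i else insert e i)" "e \<notin> i \<Longrightarrow> h = i" by (auto simp: h_def)
    then show ?thesis using * nu by (auto simp: left_diff_distrib)
  qed
  finally show "pmf (bind_pmf \<nu> ?K) i = pmf \<mu> i" .
qed

text \<open>The summand for \<open>e\<close> and \<open>h\<close> is the amount by which the conditional probability of
  \<open>e \<in> X\<close>, given \<open>X - {e} = h\<close>, falls short of \<open>p\<close>, weighted by the probability of that
  condition. Averaging over part of \<open>h\<close> only decreases it, so the elements can be revealed one by one.\<close>

lemma dominating_coupling:
  fixes \<mu> :: "'a set pmf"
  assumes "finite E" "0 \<le> p" "p \<le> 1" "set_pmf \<mu> \<subseteq> Pow E"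
  shows "\<exists>\<Gamma>. map_pmf fst \<Gamma> = random_subset E p \<and> map_pmf snd \<Gamma> = \<mu> \<and>
    measure_pmf.prob \<Gamma> {z. \<not> fst z \<subseteq> snd z} \<le>
      (\<Sum>e\<in>E. \<Sum>h\<in>Pow (E - {e}).
        max 0 (p * (pmf \<mu> h + pmf \<mu> (insert e h)) - pmf \<mu> (insert e h)))"
  using assms(1,4)
proof (induction E arbitrary: \<mu> rule: finite_induct)
  case empty
  have "\<mu> = return_pmf {}" using empty by (intro set_pmf_subset_singleton[THEN iffD1]) auto
  then show ?case by (intro exI[of _ "return_pmf ({}, {})"]) auto
next
  case (insert e E)
  let ?d = "\<lambda>(\<mu> :: 'a set pmf) e h. max 0 (p * (pmf \<mu> h + pmf \<mu> (insert e h)) - pmf \<mu> (insert e h))"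
  \<comment> \<open>The element \<open>e\<close> is revealed last: the induction hypothesis couples
    the sets without \<open>e\<close>, and a pair of coupled coins then decides about
    \<open>e\<close>.\<close>
  define \<nu> where "\<nu> = map_pmf (\<lambda>X. X - {e}) \<mu>"
  have nu: "pmf \<nu> h = pmf \<mu> h + pmf \<mu> (insert e h)" if "e \<notin> h" for h
    unfolding \<nu>_def by (rule pmf_map_remove[OF that])
  define q where "q X = pmf \<mu> (insert e X) / pmf \<nu> X" for X
  have q: "0 \<le> q h" "q h \<le> 1" if "e \<notin> h" for h
    unfolding q_def nu[OF that] by (simp_all add: pmf_nonneg divide_le_eq_1)
      (use pmf_nonneg[of \<mu> h] pmf_nonneg[of \<mu> "insert e h"] in linarith)
  have "set_pmf \<nu> \<subseteq> Pow E" using insert by (auto simp: \<nu>_def)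
  from insert.IH[OF this] obtain \<Gamma>' where \<Gamma>': "map_pmf fst \<Gamma>' = random_subset E p"
    "map_pmf snd \<Gamma>' = \<nu>"
    "measure_pmf.prob \<Gamma>' {z. \<not> fst z \<subseteq> snd z} \<le> (\<Sum>x\<in>E. \<Sum>h\<in>Pow (E - {x}). ?d \<nu> x h)"
    by blast
  define good where "good X T \<longleftrightarrow> map_pmf fst T = bernoulli_pmf p \<and> map_pmf snd T = bernoulli_pmf (q X) \<and>
    measure_pmf.prob T {z. fst z \<and> \<not> snd z} = max 0 (p - q X)" for X T
  have good: "\<exists>T. good X T" if e: "e \<notin> X" for X
    by (rule bernoulli_coupling[OF assms(2,3) q[OF e]]) (auto simp: good_def)
  \<comment> \<open>Only for \<open>X\<close> without \<open>e\<close> is \<open>q X\<close> known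
    to be a probability; for other \<open>X\<close> the value is arbitrary, and it is never sampled
    because \<nu> lives on subsets of \<open>E\<close>.\<close>
  define B where "B X = (SOME T. good X T)" for X
  have "good X (B X)" if "e \<notin> X" for X
    unfolding B_def by (rule someI_ex[OF good[OF that]])
  then have B: "\<And>X. e \<notin> X \<Longrightarrow> map_pmf fst (B X) = bernoulli_pmf p"
    "\<And>X. e \<notin> X \<Longrightarrow> map_pmf snd (B X) = bernoulli_pmf (q X)"
    "\<And>X. e \<notin> X \<Longrightarrow> measure_pmf.prob (B X) {z. fst z \<and> \<not> snd z} = max 0 (p - q X)"
    by (simp_all add: good_def)
  define ins where "ins b Z = (if b then insert e Z else Z)" for b and Z :: "'a set"
  define K where "K z = map_pmf (\<lambda>w. (ins (fst w) (fst z), ins (snd w) (snd z))) (B (snd z))"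
    for z :: "'a set \<times> 'a set"
  define \<Gamma> where "\<Gamma> = bind_pmf \<Gamma>' K"
  have supp: "fst z \<subseteq> E" "snd z \<subseteq> E" "e \<notin> snd z" "e \<notin> fst z" if "z \<in> set_pmf \<Gamma>'" for z
  proof -
    have "fst z \<in> set_pmf (map_pmf fst \<Gamma>')" "snd z \<in> set_pmf (map_pmf snd \<Gamma>')" using that by auto
    then show "fst z \<subseteq> E" "snd z \<subseteq> E"
      using \<open>set_pmf \<nu> \<subseteq> Pow E\<close> set_pmf_random_subset[OF insert.hyps(1)]
      unfolding \<Gamma>'(1,2) by auto
    then show "e \<notin> snd z" "e \<notin> fst z" using insert.hyps by auto
  qed
  have "map_pmf fst \<Gamma> = bind_pmf \<Gamma>' (\<lambda>z. map_pmf (\<lambda>s. ins s (fst z)) (map_pmf fst (B (snd z))))"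
    by (simp add: \<Gamma>_def K_def map_bind_pmf map_pmf_comp)
  also have "\<dots> = bind_pmf \<Gamma>' (\<lambda>z. map_pmf (\<lambda>s. ins s (fst z)) (bernoulli_pmf p))"
    using supp B by (intro bind_pmf_cong) auto
  also have "\<dots> = bind_pmf (random_subset E p) (\<lambda>Y. map_pmf (\<lambda>s. ins s Y) (bernoulli_pmf p))"
    by (simp add: \<Gamma>'(1)[symmetric] bind_map_pmf)
  also have "\<dots> = random_subset (insert e E) p"
    unfolding random_subset_insert[OF insert.hyps] ins_def map_pmf_def by (rule bind_commute_pmf)
  finally have fst: "map_pmf fst \<Gamma> = random_subset (insert e E) p" .
  have "map_pmf snd \<Gamma> = bind_pmf \<Gamma>' (\<lambda>z. map_pmf (\<lambda>s. ins s (snd z)) (map_pmf snd (B (snd z))))"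
    by (simp add: \<Gamma>_def K_def map_bind_pmf map_pmf_comp)
  also have "\<dots> = bind_pmf \<Gamma>' (\<lambda>z. map_pmf (\<lambda>s. ins s (snd z)) (bernoulli_pmf (q (snd z))))"
    using supp B by (intro bind_pmf_cong) auto
  also have "\<dots> = bind_pmf \<nu> (\<lambda>X. map_pmf (\<lambda>s. ins s X) (bernoulli_pmf (q X)))"
    by (simp add: \<Gamma>'(2)[symmetric] bind_map_pmf)
  also have "\<dots> = \<mu>"
    unfolding q_def \<nu>_def ins_def by (rule resample_element)
  finally have snd: "map_pmf snd \<Gamma> = \<mu>" .
  let ?S = "{z :: 'a set \<times> 'a set. \<not> fst z \<subseteq> snd z}"
  have fin: "finite (set_pmf \<Gamma>')"
  proof (rule finite_subset)
    show "set_pmf \<Gamma>' \<subseteq> Pow E \<times> Pow E" 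
    proof
      fix z assume "z \<in> set_pmf \<Gamma>'"
      from supp(1,2)[OF this] show "z \<in> Pow E \<times> Pow E" by (simp add: mem_Times_iff)
    qed
  qed (use insert.hyps in auto)
  have "measure_pmf.prob \<Gamma> ?S = (\<integral>z. measure_pmf.prob (K z) ?S \<partial>\<Gamma>')"
    unfolding \<Gamma>_def by (rule prob_bind_pmf)
  \<comment> \<open>Containment fails after this step only if it failed before or if the coin of the
    binomial side succeeds alone.\<close>
  also have "\<dots> \<le> (\<integral>z. indicator ?S z + max 0 (p - q (snd z)) \<partial>\<Gamma>')"
  proof (rule integral_mono_AE)
    show "AE z in \<Gamma>'. measure_pmf.prob (K z) ?S \<le> indicator ?S z + max 0 (p - q (snd z))"
    proof (clarsimp simp only: AE_measure_pmf_iff)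
      fix z assume z: "z \<in> set_pmf \<Gamma>'"
      show "measure_pmf.prob (K z) ?S \<le> indicator ?S z + max 0 (p - q (snd z))"
      proof (cases "z \<in> ?S")
        case True
        have "measure_pmf.prob (K z) ?S \<le> 1" by simp
        moreover have "0 \<le> max 0 (p - q (snd z))" by simp
        ultimately have "measure_pmf.prob (K z) ?S \<le> 1 + max 0 (p - q (snd z))" by linarith
        then show ?thesis using True by simp
      next
        case False
        have "measure_pmf.prob (K z) ?S \<le> measure_pmf.prob (B (snd z)) {w. fst w \<and> \<not> snd w}"
          unfolding K_def measure_map_pmf using False
          by (intro measure_pmf.finite_measure_mono) (auto simp: ins_def split: if_splits)
        then show ?thesis using B(3)[OF supp(3)[OF z]] False by simp
      qed
    qed
  qed (use fin in \<open>auto intro: integrable_measure_pmf_finite\<close>)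
  also have "\<dots> = measure_pmf.prob \<Gamma>' ?S + (\<integral>z. max 0 (p - q (snd z)) \<partial>\<Gamma>')"
    by (subst Bochner_Integration.integral_add) (use fin in \<open>auto intro: integrable_measure_pmf_finite\<close>)
  also have "(\<integral>z. max 0 (p - q (snd z)) \<partial>\<Gamma>') = (\<integral>X. max 0 (p - q X) \<partial>\<nu>)"
    by (simp add: \<Gamma>'(2)[symmetric])
  also have "\<dots> = (\<Sum>X\<in>Pow E. max 0 (p - q X) * pmf \<nu> X)"
    using insert.hyps \<open>set_pmf \<nu> \<subseteq> Pow E\<close> by (intro integral_measure_pmf_real) auto
  also have "\<dots> = (\<Sum>X\<in>Pow E. ?d \<mu> e X)"
  proof (rule sum.cong[OF refl])
    fix X assume "X \<in> Pow E"
    then have e: "e \<notin> X" using insert.hyps by auto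
    have *: "q X * pmf \<nu> X = pmf \<mu> (insert e X)"
      using pmf_nonneg[of \<mu> X] pmf_nonneg[of \<mu> "insert e X"] nu[OF e]
      by (cases "pmf \<nu> X = 0") (simp_all add: q_def add_nonneg_eq_0_iff)
    show "max 0 (p - q X) * pmf \<nu> X = ?d \<mu> e X"
      using * by (simp add: max_mult_distrib_right left_diff_distrib nu[OF e, symmetric] pmf_nonneg)
  qed
  also have "measure_pmf.prob \<Gamma>' ?S \<le> (\<Sum>x\<in>E. \<Sum>h\<in>Pow (insert e E - {x}). ?d \<mu> x h)"
  proof -
    have "(\<Sum>h\<in>Pow (E - {x}). ?d \<nu> x h) \<le> (\<Sum>h\<in>Pow (insert e E - {x}). ?d \<mu> x h)" if x: "x \<in> E" for x
    proof -
      have xe: "x \<noteq> e" using x insert.hyps by auto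
      have "(\<Sum>h\<in>Pow (E - {x}). ?d \<nu> x h) \<le> (\<Sum>h\<in>Pow (E - {x}). ?d \<mu> x h + ?d \<mu> x (insert e h))"
      proof (rule sum_mono)
        fix h assume "h \<in> Pow (E - {x})"
        then have "e \<notin> h" "e \<notin> insert x h" using insert.hyps xe by auto
        \<comment> \<open>Both masses of \<nu> split according to the membership of
          \<open>e\<close>, and \<open>max 0\<close> is subadditive.\<close>
        then show "?d \<nu> x h \<le> ?d \<mu> x h + ?d \<mu> x (insert e h)"
          by (simp add: nu insert_commute[of e x] max_def algebra_simps)
      qed
      also have "\<dots> = (\<Sum>h\<in>Pow (E - {x}). ?d \<mu> x h) + (\<Sum>h\<in>insert e ` Pow (E - {x}). ?d \<mu> x h)"
      proof -
        have "inj_on (insert e) (Pow (E - {x}))" using insert.hyps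
          by (intro inj_onI) (metis Diff_iff PowD insert_ident subsetD)
        then show ?thesis by (simp add: sum.distrib sum.reindex)
      qed
      also have "\<dots> = (\<Sum>h\<in>Pow (insert e (E - {x})). ?d \<mu> x h)"
        unfolding Pow_insert using insert.hyps
        by (intro sum.union_disjoint[symmetric]) auto
      also have "insert e (E - {x}) = insert e E - {x}" using xe by auto
      finally show ?thesis .
    qed
    then show ?thesis using \<Gamma>'(3) by (meson order_trans sum_mono)
  qed
  finally have "measure_pmf.prob \<Gamma> ?S \<le>
      (\<Sum>x\<in>E. \<Sum>h\<in>Pow (insert e E - {x}). ?d \<mu> x h) + (\<Sum>X\<in>Pow E. ?d \<mu> e X)"
    by simp
  also have "\<dots> = (\<Sum>x\<in>insert e E. \<Sum>h\<in>Pow (insert e E - {x}). ?d \<mu> x h)"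
    using insert.hyps by simp
  finally show ?case using fst snd by blast
qed

section \<open>Graphs with a given number of edges\<close>

definition sized_subsets :: "'a set \<Rightarrow> nat \<Rightarrow> 'a set set" where
  "sized_subsets E M = {G. G \<subseteq> E \<and> card G = M}"

lemma finite_sized_subsets [simp]: "finite E \<Longrightarrow> finite (sized_subsets E M)"
  by (rule finite_subset[of _ "Pow E"]) (auto simp: sized_subsets_def)

section \<open>The Chernoff bound for uniformly random subsets of fixed size\<close>

text \<open>The quotient of the two binomials is the product of \<open>(M - i) / (N - i)\<close>
  over \<open>i < k\<close>, and each factor is at most \<open>M / N\<close>.\<close>

lemma binomial_diff_le:
  assumes "k \<le> M" "M \<le> N"
  shows "real ((N - k) choose (M - k)) \<le> (real M / real N) ^ k * real (N choose M)"
  using assms(1)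
proof (induction k)
  case (Suc k)
  have "(M - k) * ((N - k) choose (M - k)) = (N - k) * ((N - k - 1) choose (M - k - 1))"
    using Suc.prems by (intro times_binomial_minus1_eq) auto
  then have "real (M - k) * real ((N - k) choose (M - k)) =
      real (N - k) * real ((N - Suc k) choose (M - Suc k))"
    by (simp flip: of_nat_mult)
  moreover have "real (N - k) > 0" using Suc.prems assms by simp
  ultimately have "real ((N - Suc k) choose (M - Suc k)) =
      real (M - k) / real (N - k) * real ((N - k) choose (M - k))"
    by (simp add: field_simps)
  also have "\<dots> \<le> real M / real N * ((real M / real N) ^ k * real (N choose M))"
  proof (rule mult_mono)
    have "real k * real M \<le> real k * real N" using assms by (intro mult_left_mono) auto
    then show "real (M - k) / real (N - k) \<le> real M / real N"
      using Suc.prems assms by (simp add: divide_simps of_nat_diff algebra_simps)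
  qed (use Suc in auto)
  finally show ?case by (simp add: mult.assoc)
qed simp

text \<open>In the uniform model, containing \<open>K\<close> is no likelier than with independent
  elements of the same density. This replaces independence in the Chernoff bound.\<close>

lemma card_sized_supersets_le:
  assumes "finite E" "K \<subseteq> E"
  shows "real (card {G \<in> sized_subsets E M. K \<subseteq> G}) \<le>
    (real M / real (card E)) ^ card K * real (card (sized_subsets E M))"
proof (cases "card K \<le> M \<and> M \<le> card E")
  case True
  have finK: "finite K" using assms finite_subset by blast
  have "card {G \<in> sized_subsets E M. K \<subseteq> G} \<le> card {H. H \<subseteq> E - K \<and> card H = M - card K}"
  proof (rule card_inj_on_le[of "\<lambda>G. G - K"])
    show "inj_on (\<lambda>G. G - K) {G \<in> sized_subsets E M. K \<subseteq> G}"
      by (rule inj_onI) blast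
    show "(\<lambda>G. G - K) ` {G \<in> sized_subsets E M. K \<subseteq> G} \<subseteq> {H. H \<subseteq> E - K \<and> card H = M - card K}"
      using finK by (auto simp: sized_subsets_def card_Diff_subset)
  qed (use assms in auto)
  also have "\<dots> = (card E - card K) choose (M - card K)"
    using assms finK by (subst n_subsets) (auto simp: card_Diff_subset)
  finally have "real (card {G \<in> sized_subsets E M. K \<subseteq> G}) \<le> real ((card E - card K) choose (M - card K))"
    by simp
  also have "\<dots> \<le> (real M / real (card E)) ^ card K * real (card E choose M)"
    using True by (intro binomial_diff_le) auto
  also have "card E choose M = card (sized_subsets E M)"
    using n_subsets[OF assms(1), of M] by (simp add: sized_subsets_def)
  finally show ?thesis .
next
  case False
  have "{G \<in> sized_subsets E M. K \<subseteq> G} = {}"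
  proof -
    have "card K \<le> M \<and> M \<le> card E" if "G \<subseteq> E" "card G = M" "K \<subseteq> G" for G
      using that card_mono[OF finite_subset[OF that(1) assms(1)] that(3)] card_mono[OF assms(1) that(1)]
      by simp
    then show ?thesis using False by (auto simp: sized_subsets_def)
  qed
  then have "card {G \<in> sized_subsets E M. K \<subseteq> G} = 0" by (simp only: card.empty)
  then show ?thesis by simp
qed

text \<open>Expanding the power over the subsets of \<open>G \<inter> F\<close> turns the
  exponential moment into containment counts, so it is at most that of the independent
  model.\<close>

lemma sum_sized_subsets_pow_card_le:
  fixes x :: real
  assumes "finite E" "F \<subseteq> E" "0 \<le> x"
  shows "(\<Sum>G\<in>sized_subsets E M. (1 + x) ^ card (G \<inter> F)) \<le>
    real (card (sized_subsets E M)) * (1 + x * (real M / real (card E))) ^ card F"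
proof -
  let ?S = "sized_subsets E M" and ?q = "real M / real (card E)"
  have finF: "finite F" using assms finite_subset by blast
  have "(1 + x) ^ card (G \<inter> F) = (\<Sum>K\<in>Pow F. if K \<subseteq> G then x ^ card K else 0)" for G
  proof -
    have "(1 + x) ^ card (G \<inter> F) = (\<Sum>K\<in>Pow (G \<inter> F). x ^ card K)"
      using finF by (intro sum_pow_card[symmetric]) auto
    also have "Pow (G \<inter> F) = {K \<in> Pow F. K \<subseteq> G}" by auto
    also have "(\<Sum>K\<in>{K \<in> Pow F. K \<subseteq> G}. x ^ card K) = (\<Sum>K\<in>Pow F. if K \<subseteq> G then x ^ card K else 0)"
      using finF by (intro sum.inter_filter) auto
    finally show ?thesis .
  qed
  then have "(\<Sum>G\<in>?S. (1 + x) ^ card (G \<inter> F)) = (\<Sum>K\<in>Pow F. \<Sum>G\<in>?S. if K \<subseteq> G then x ^ card K else 0)"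
    by (simp add: sum.swap[of _ ?S])
  also have "\<dots> = (\<Sum>K\<in>Pow F. x ^ card K * real (card {G \<in> ?S. K \<subseteq> G}))"
    using assms by (simp add: sum.inter_filter[symmetric] mult.commute)
  also have "\<dots> \<le> (\<Sum>K\<in>Pow F. x ^ card K * (?q ^ card K * real (card ?S)))"
    using assms by (intro sum_mono mult_left_mono card_sized_supersets_le) auto
  also have "\<dots> = real (card ?S) * (\<Sum>K\<in>Pow F. (x * ?q) ^ card K)"
    unfolding sum_distrib_left by (intro sum.cong refl) (simp add: power_mult_distrib power_divide)
  also have "(\<Sum>K\<in>Pow F. (x * ?q) ^ card K) = (1 + x * ?q) ^ card F"
    by (rule sum_pow_card[OF finF])
  finally show ?thesis .
qed

lemma card_sized_subsets_upper_tail: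
  assumes "finite E" "F \<subseteq> E" "0 < L" "real (card F) \<le> L" "0 \<le> \<tau>"
  shows "real (card {G \<in> sized_subsets E M.
      real (card (G \<inter> F)) > real M / real (card E) * real (card F) + \<tau>}) \<le>
    real (card (sized_subsets E M)) * exp (- (\<tau>\<^sup>2 / (4 * L)))"
proof -
  let ?S = "sized_subsets E M" and ?q = "real M / real (card E)"
  let ?B = "{G \<in> ?S. real (card (G \<inter> F)) > ?q * real (card F) + \<tau>}"
  define x where "x = \<tau> / (2 * L)"
  have x: "0 \<le> x" using assms by (simp add: x_def)
  define c where "c = (1 + x * ?q) ^ card F"
  have "1 + x * ?q > 0" using x by (auto intro!: add_pos_nonneg mult_nonneg_nonneg)
  then have c: "c > 0" by (simp add: c_def)
  have finF: "finite F" using assms finite_subset by blast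
  have "real (card ?B) * (exp (\<tau>\<^sup>2 / (4 * L)) * c) \<le> (\<Sum>G\<in>?B. (1 + x) ^ card (G \<inter> F))"
  proof (rule sum_bounded_below)
    fix G assume G: "G \<in> ?B"
    have "card (G \<inter> F) \<le> card F" using finF by (intro card_mono) auto
    from chernoff_pointwise[OF this, of L ?q \<tau>] G assms
    show "exp (\<tau>\<^sup>2 / (4 * L)) * c \<le> (1 + x) ^ card (G \<inter> F)" by (simp add: c_def x_def)
  qed
  also have "\<dots> \<le> (\<Sum>G\<in>?S. (1 + x) ^ card (G \<inter> F))"
    using assms x by (intro sum_mono2) auto
  also have "\<dots> \<le> real (card ?S) * c"
    unfolding c_def by (rule sum_sized_subsets_pow_card_le[OF assms(1,2) x])
  finally have "real (card ?B) * exp (\<tau>\<^sup>2 / (4 * L)) \<le> real (card ?S)"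
    using c by (simp add: mult.assoc[symmetric])
  then show ?thesis by (simp add: exp_minus field_simps)
qed

section \<open>Degrees and edge counts in graphs on \<open>{1..n}\<close>\<close>

lemma finite_complete_edges [simp]: "finite (complete_edges n)"
  by (rule finite_subset[of _ "Pow {1..n}"]) (auto simp: complete_edges_def)

lemma finite_subset_complete_edges: "G \<subseteq> complete_edges n \<Longrightarrow> finite G"
  using finite_subset finite_complete_edges by blast

lemma card_complete_edges: "real (card (complete_edges n)) = real n * (real n - 1) / 2"
proof -
  have "card (complete_edges n) = n choose 2"
    unfolding complete_edges_def by (subst n_subsets) auto
  moreover have "even (n * (n - 1))" by (cases n) auto
  ultimately have "2 * card (complete_edges n) = n * (n - 1)"
    by (simp add: choose_two)
  then have "2 * real (card (complete_edges n)) = real n * real (n - 1)"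
    by (metis of_nat_mult of_nat_numeral)
  then show ?thesis by (cases n) auto
qed

lemma doubleton_in_complete_edges:
  "{x, y} \<in> complete_edges n \<longleftrightarrow> x \<in> {1..n} \<and> y \<in> {1..n} \<and> x \<noteq> y"
  by (auto simp: complete_edges_def card_insert_if)

lemma degree_eq_card_neighbours:
  assumes "G \<subseteq> complete_edges n"
  shows "degree G u = card {x \<in> {1..n}. {u, x} \<in> G}"
proof -
  have "bij_betw (\<lambda>x. {u, x}) {x \<in> {1..n}. {u, x} \<in> G} {e \<in> G. u \<in> e}"
  proof (rule bij_betw_imageI)
    show "inj_on (\<lambda>x. {u, x}) {x \<in> {1..n}. {u, x} \<in> G}"
      by (auto simp: inj_on_def doubleton_eq_iff)
    show "(\<lambda>x. {u, x}) ` {x \<in> {1..n}. {u, x} \<in> G} = {e \<in> G. u \<in> e}"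
    proof (intro set_eqI iffI)
      fix e assume e: "e \<in> {e \<in> G. u \<in> e}"
      then have "card e = 2" "e \<subseteq> {1..n}" using assms by (auto simp: complete_edges_def)
      then obtain a b where "e = {a, b}" by (auto simp: card_2_iff)
      then obtain x where "e = {u, x}" using e by auto
      then show "e \<in> (\<lambda>x. {u, x}) ` {x \<in> {1..n}. {u, x} \<in> G}"
        using e \<open>e \<subseteq> {1..n}\<close> by auto
    qed auto
  qed
  then show ?thesis by (simp add: degree_def bij_betw_same_card)
qed

lemma degree_complete_edges:
  assumes "v \<in> {1..n}"
  shows "degree (complete_edges n) v = n - 1"
proof -
  have "{x \<in> {1..n}. {v, x} \<in> complete_edges n} = {1..n} - {v}"
    using assms by (auto simp: doubleton_in_complete_edges)
  then show ?thesis using assms by (simp add: degree_eq_card_neighbours[OF order_refl] card_Diff_subset del: atLeastAtMost_iff)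
qed

lemma sum_degree:
  assumes "G \<subseteq> complete_edges n"
  shows "(\<Sum>v\<in>{1..n}. degree G v) = 2 * card G"
proof -
  have fin: "finite G" using assms by (rule finite_subset_complete_edges)
  have "(\<Sum>v\<in>{1..n}. degree G v) = (\<Sum>v\<in>{1..n}. \<Sum>e\<in>G. if v \<in> e then 1 else 0)"
    using fin by (simp add: degree_def sum.inter_filter[symmetric])
  also have "\<dots> = (\<Sum>e\<in>G. \<Sum>v\<in>{1..n}. if v \<in> e then 1 else 0)" by (rule sum.swap)
  also have "\<dots> = (\<Sum>e\<in>G. card {v \<in> {1..n}. v \<in> e})"
    by (simp add: sum.inter_filter[symmetric])
  also have "\<dots> = (\<Sum>e\<in>G. 2)"
  proof (rule sum.cong[OF refl])
    fix e assume "e \<in> G"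
    then have "card e = 2" "e \<subseteq> {1..n}" using assms by (auto simp: complete_edges_def)
    moreover from this(2) have "{v \<in> {1..n}. v \<in> e} = e" by blast
    ultimately show "card {v \<in> {1..n}. v \<in> e} = 2" by metis
  qed
  finally show ?thesis by simp
qed

section \<open>Edge moves and the proportion of regular graphs\<close>

text \<open>The additive form with indicators avoids truncated subtraction, so successive
  replacements combine by linear arithmetic.\<close>

lemma degree_replace_edge:
  assumes "finite G" "a \<in> G" "b \<notin> G"
  shows "degree (insert b (G - {a})) x + of_bool (x \<in> a) = degree G x + of_bool (x \<in> b)"
proof -
  have "{e \<in> insert b (G - {a}). x \<in> e} =
      (if x \<in> b then insert b ({e \<in> G. x \<in> e} - {a}) else {e \<in> G. x \<in> e} - {a})" by auto
  moreover have "card ({e \<in> G. x \<in> e} - {a}) + of_bool (x \<in> a) = card {e \<in> G. x \<in> e}"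
  proof (cases "x \<in> a")
    case True
    then have "Suc (card ({e \<in> G. x \<in> e} - {a})) = card {e \<in> G. x \<in> e}"
      using assms by (intro card_Suc_Diff1) auto
    then show ?thesis using True by simp
  qed simp
  ultimately show ?thesis using assms by (simp add: degree_def)
qed

text \<open>Truncated subtraction: only vertices of degree above \<open>d\<close> contribute.\<close>

definition excess :: "nat \<Rightarrow> nat \<Rightarrow> graph \<Rightarrow> nat" where
  "excess n d G = (\<Sum>v\<in>{1..n}. degree G v - d)"

text \<open>The mean degree is \<open>d\<close>, so a vertex \<open>u\<close> above \<open>d\<close>
  comes with a vertex \<open>v\<close> below \<open>d\<close>. Then \<open>u\<close> has a neighbour
  \<open>w\<close> that is neither \<open>v\<close> nor adjacent to \<open>v\<close>, and
  \<open>uw\<close> moves to \<open>vw\<close>. The last conclusion recovers \<open>G\<close> from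
  \<open>G1\<close> and three vertices.\<close>

lemma reduce_excess:
  assumes "G \<in> sized_subsets (complete_edges n) M" "2 * M = d * n" "excess n d G = Suc t"
  obtains u v w G1 where "u \<in> {1..n}" "v \<in> {1..n}" "w \<in> {1..n}"
    "G1 \<in> sized_subsets (complete_edges n) M" "excess n d G1 = t"
    "G = insert {u, w} (G1 - {{v, w}})"
proof -
  have G: "G \<subseteq> complete_edges n" "card G = M" using assms(1) by (auto simp: sized_subsets_def)
  have fin: "finite G" using G(1) by (rule finite_subset_complete_edges)
  obtain u where u: "u \<in> {1..n}" "degree G u > d"
  proof -
    have "excess n d G \<noteq> 0" using assms(3) by simp
    then show ?thesis using that unfolding excess_def by (auto simp: sum_eq_0_iff)
  qed
  obtain v where v: "v \<in> {1..n}" "degree G v < d"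
  proof -
    have "\<exists>v\<in>{1..n}. degree G v < d"
    proof (rule ccontr)
      assume "\<not> ?thesis"
      then have "(\<Sum>v\<in>{1..n}. d) < (\<Sum>v\<in>{1..n}. degree G v)"
        using u by (intro sum_strict_mono_ex1) (auto simp: not_less)
      then show False using sum_degree[OF G(1)] G(2) assms(2) by (simp add: mult.commute)
    qed
    then show ?thesis using that by blast
  qed
  have uv: "u \<noteq> v" using u v by auto
  let ?N = "\<lambda>u. {x \<in> {1..n}. {u, x} \<in> G}"
  have notself: "{x} \<notin> G" for x using G(1) by (auto simp: complete_edges_def)
  \<comment> \<open>Otherwise every neighbour of \<open>u\<close> apart from \<open>v\<close> is a
    neighbour of \<open>v\<close>, and \<open>degree G u \<le> degree G v\<close> follows; a
    possible edge \<open>uv\<close> counts once on both sides.\<close>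
  have "\<exists>w\<in>?N u. w \<noteq> v \<and> {v, w} \<notin> G"
  proof (rule ccontr)
    assume "\<not> ?thesis"
    then have sub: "?N u - {v} \<subseteq> ?N v - {u}" using notself by auto
    have "card (?N u - {v}) \<le> card (?N v - {u})" by (rule card_mono[OF _ sub]) auto
    moreover have "card (?N u) = card (?N u - {v}) + of_bool ({u, v} \<in> G)"
      using v card_Suc_Diff1[of "?N u" v] by auto
    moreover have "card (?N v) = card (?N v - {u}) + of_bool ({u, v} \<in> G)"
      using u card_Suc_Diff1[of "?N v" u] by (auto simp: insert_commute)
    ultimately have "degree G u \<le> degree G v"
      using G(1) by (simp add: degree_eq_card_neighbours)
    then show False using u v by simp
  qed
  then obtain w where w: "w \<in> {1..n}" "{u, w} \<in> G" "w \<noteq> v" "{v, w} \<notin> G" by auto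
  have wu: "w \<noteq> u" using w notself by auto
  define G1 where "G1 = insert {v, w} (G - {{u, w}})"
  have "card G1 = M" 
    unfolding G1_def using fin w(4) G(2) card_Suc_Diff1[OF fin w(2)] by simp
  moreover have "G1 \<subseteq> complete_edges n"
    using G(1) v w by (auto simp: G1_def doubleton_in_complete_edges)
  ultimately have G1: "G1 \<in> sized_subsets (complete_edges n) M" by (simp add: sized_subsets_def)
  have deg: "degree G1 x + of_bool (x \<in> {u, w}) = degree G x + of_bool (x \<in> {v, w})" for x
    unfolding G1_def by (rule degree_replace_edge[OF fin w(2,4)])
  \<comment> \<open>Truncation matters here: \<open>u\<close> is above \<open>d\<close> and loses 1,
    \<open>v\<close> is below \<open>d\<close> so its term stays 0, and \<open>w\<close> keeps its
    degree.\<close>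
  have "(degree G1 x - d) + of_bool (x = u) = degree G x - d" for x
    using deg[of x] u v uv w(3) wu by (auto split: if_splits simp: of_bool_def)
  then have "(\<Sum>x\<in>{1..n}. degree G x - d) = (\<Sum>x\<in>{1..n}. (degree G1 x - d) + of_bool (x = u))"
    by simp
  also have "\<dots> = excess n d G1 + 1"
    using u by (simp add: sum.distrib excess_def)
  finally have "excess n d G1 = t" using assms(3) by (simp add: excess_def)
  moreover have "G = insert {u, w} (G1 - {{v, w}})"
    using w uv by (auto simp: G1_def doubleton_eq_iff)
  ultimately show ?thesis using that u v w G1 by blast
qed

text \<open>The number of edges fixes the degree sum at \<open>d * n\<close>, so a graph with no
  vertex above \<open>d\<close> has none below \<open>d\<close>.\<close>

lemma regular_graphs_eq_excess_0:
  assumes "2 * M = d * n"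
  shows "regular_graphs n d = {G \<in> sized_subsets (complete_edges n) M. excess n d G = 0}"
proof (intro set_eqI iffI)
  fix G assume "G \<in> regular_graphs n d"
  then have G: "G \<subseteq> complete_edges n" "\<And>v. v \<in> {1..n} \<Longrightarrow> degree G v = d"
    by (auto simp: regular_graphs_def)
  then have "2 * card G = n * d" using sum_degree[OF G(1)] by simp
  then show "G \<in> {G \<in> sized_subsets (complete_edges n) M. excess n d G = 0}"
    using G assms by (simp add: sized_subsets_def excess_def mult.commute)
next
  fix G assume "G \<in> {G \<in> sized_subsets (complete_edges n) M. excess n d G = 0}"
  then have G: "G \<subseteq> complete_edges n" "card G = M" "\<And>v. v \<in> {1..n} \<Longrightarrow> degree G v \<le> d"
    by (auto simp: sized_subsets_def excess_def)
  have "degree G v = d" if v: "v \<in> {1..n}" for v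
  proof (rule ccontr)
    assume "degree G v \<noteq> d"
    then have "(\<Sum>v\<in>{1..n}. degree G v) < (\<Sum>v\<in>{1..n}. d)"
      using v G(3) by (intro sum_strict_mono_ex1) (auto simp: order_less_le)
    then show False using sum_degree[OF G(1)] G(2) assms by (simp add: mult.commute)
  qed
  then show "G \<in> regular_graphs n d" using G(1) by (simp add: regular_graphs_def)
qed

text \<open>A graph of excess \<open>Suc t\<close> is determined by one of excess \<open>t\<close>
  and three vertices through the reversed edge move, hence the factor \<open>n ^ 3\<close>.\<close>

lemma card_excess_Suc_le:
  assumes "2 * M = d * n"
  shows "card {G \<in> sized_subsets (complete_edges n) M. excess n d G = Suc t} \<le>
    n ^ 3 * card {G \<in> sized_subsets (complete_edges n) M. excess n d G = t}"
proof -
  let ?A = "\<lambda>t. {G \<in> sized_subsets (complete_edges n) M. excess n d G = t}"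
  let ?V = "{1..n}"
  let ?f = "\<lambda>(G1, u, v, w). insert {u, w} (G1 - {{v, w}}) :: graph"
  have "?A (Suc t) \<subseteq> ?f ` (?A t \<times> ?V \<times> ?V \<times> ?V)"
  proof
    fix G assume "G \<in> ?A (Suc t)"
    then have "G \<in> sized_subsets (complete_edges n) M" "excess n d G = Suc t" by auto
    then obtain u v w G1 where "u \<in> ?V" "v \<in> ?V" "w \<in> ?V" "G1 \<in> ?A t"
      "G = insert {u, w} (G1 - {{v, w}})"
      by (rule reduce_excess[OF _ assms]) auto
    then show "G \<in> ?f ` (?A t \<times> ?V \<times> ?V \<times> ?V)"
      by (intro image_eqI[of _ _ "(G1, u, v, w)"]) auto
  qed
  then have "card (?A (Suc t)) \<le> card (?A t \<times> ?V \<times> ?V \<times> ?V)"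
    by (rule surj_card_le[rotated]) simp
  then show ?thesis by (simp add: card_cartesian_product power3_eq_cube mult_ac)
qed

lemma card_excess_le:
  assumes "2 * M = d * n" "n \<ge> 1"
  shows "card {G \<in> sized_subsets (complete_edges n) M. excess n d G \<le> T} \<le>
    (T + 1) * n ^ (3 * T) * card (regular_graphs n d)"
proof -
  let ?A = "\<lambda>t. {G \<in> sized_subsets (complete_edges n) M. excess n d G = t}"
  have *: "card (?A t) \<le> n ^ (3 * t) * card (regular_graphs n d)" for t
  proof (induction t)
    case 0
    then show ?case using regular_graphs_eq_excess_0[OF assms(1)] by simp
  next
    case (Suc t)
    have "card (?A (Suc t)) \<le> n ^ 3 * card (?A t)" by (rule card_excess_Suc_le[OF assms(1)])
    also have "\<dots> \<le> n ^ 3 * (n ^ (3 * t) * card (regular_graphs n d))" using Suc by (rule mult_left_mono) simp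
    finally show ?case by (simp add: power_add mult.assoc)
  qed
  have "{G \<in> sized_subsets (complete_edges n) M. excess n d G \<le> T} = (\<Union>t\<in>{..T}. ?A t)" by auto
  then have "card {G \<in> sized_subsets (complete_edges n) M. excess n d G \<le> T} \<le> (\<Sum>t\<in>{..T}. card (?A t))"
    using card_UN_le[of "{..T}" ?A] by simp
  also have "\<dots> \<le> (\<Sum>t\<in>{..T}. n ^ (3 * T) * card (regular_graphs n d))"
  proof (rule sum_mono)
    fix t assume "t \<in> {..T}"
    then have "n ^ (3 * t) \<le> n ^ (3 * T)" using assms(2) by (intro power_increasing) auto
    then show "card (?A t) \<le> n ^ (3 * T) * card (regular_graphs n d)"
      using *[of t] by (meson mult_right_mono order_trans zero_le)
  qed
  finally show ?thesis by (simp add: algebra_simps)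
qed

lemma edge_density_eq:
  assumes "2 * M = d * n" "n \<ge> 2"
  shows "real M / real (card (complete_edges n)) = real d / (real n - 1)"
proof -
  have "2 * real M = real d * real n" using assms(1) by (metis of_nat_mult of_nat_numeral)
  then have "real M = real d * real n / 2" by simp
  then show ?thesis using assms(2) by (simp add: card_complete_edges)
qed

text \<open>By the Chernoff bound for stars and a union bound over the vertices, at least half of
  the graphs with \<open>M\<close> edges have all degrees at most \<open>d + t0\<close>. These have
  excess at most \<open>T\<close>, and edge moves compare their number with that of the regular
  graphs.\<close>

lemma card_sized_subsets_le_regular_graphs:
  fixes t0 :: real
  assumes "2 * M = d * n" "n \<ge> 2" "0 \<le> t0" "real n * exp (- (t0\<^sup>2 / (4 * real n))) \<le> 1 / 2"
  defines "T \<equiv> nat \<lfloor>real n * t0\<rfloor>"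
  shows "real (card (sized_subsets (complete_edges n) M)) \<le>
    2 * (real T + 1) * real n ^ (3 * T) * real (card (regular_graphs n d))"
proof -
  let ?E = "complete_edges n"
  let ?S = "sized_subsets ?E M"
  let ?F = "\<lambda>v. {e \<in> ?E. v \<in> e}"
  let ?B = "\<lambda>v. {G \<in> ?S. real (card (G \<inter> ?F v)) > real M / real (card ?E) * real (card (?F v)) + t0}"
  let ?R = "(T + 1) * n ^ (3 * T) * card (regular_graphs n d)"
  have q: "real M / real (card ?E) = real d / (real n - 1)"
    using assms by (intro edge_density_eq) auto
  \<comment> \<open>The star of \<open>v\<close> has \<open>n - 1\<close> pairs, so at density
    \<open>d / (n - 1)\<close> its expected count is exactly \<open>d\<close>.\<close>
  have cF: "card (?F v) = n - 1" if "v \<in> {1..n}" for v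
    using degree_complete_edges[OF that] by (simp add: degree_def)
  have B: "real (card (?B v)) \<le> real (card ?S) * exp (- (t0\<^sup>2 / (4 * real n)))" if "v \<in> {1..n}" for v
    using assms cF[OF that] by (intro card_sized_subsets_upper_tail) auto
  have "?S \<subseteq> {G \<in> ?S. excess n d G \<le> T} \<union> (\<Union>v\<in>{1..n}. ?B v)"
  proof
    fix G assume G: "G \<in> ?S"
    show "G \<in> {G \<in> ?S. excess n d G \<le> T} \<union> (\<Union>v\<in>{1..n}. ?B v)"
    proof (cases "G \<in> (\<Union>v\<in>{1..n}. ?B v)")
      case False
      have deg: "real (degree G v) \<le> real d + t0" if v: "v \<in> {1..n}" for v
      proof -
        have "G \<inter> ?F v = {e \<in> G. v \<in> e}" using G by (auto simp: sized_subsets_def)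
        moreover have "real (card (G \<inter> ?F v)) \<le> real d / (real n - 1) * real (n - 1) + t0"
        proof -
          have "\<not> real (card (G \<inter> ?F v)) > real M / real (card ?E) * real (card (?F v)) + t0"
            using False G v by blast
          then show ?thesis unfolding q cF[OF v] by linarith
        qed
        moreover have "real (n - 1) = real n - 1" using assms(2) by auto
        ultimately show ?thesis using assms(2) by (simp add: degree_def)
      qed
      have "real (excess n d G) = (\<Sum>v\<in>{1..n}. real (degree G v - d))"
        by (simp add: excess_def)
      also have "\<dots> \<le> (\<Sum>v\<in>{1..n}. t0)"
      proof (rule sum_mono)
        fix v assume "v \<in> {1..n}"
        from deg[OF this] show "real (degree G v - d) \<le> t0"
          using assms(3) by (cases "degree G v \<ge> d") (auto simp: of_nat_diff)
      qed
      finally have "real (excess n d G) \<le> real n * t0" by simp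
      then have "excess n d G \<le> T" unfolding T_def by (simp add: le_nat_floor)
      then show ?thesis using G by simp
    qed simp
  qed
  then have "card ?S \<le> card ({G \<in> ?S. excess n d G \<le> T} \<union> (\<Union>v\<in>{1..n}. ?B v))"
    by (intro card_mono) auto
  also have "\<dots> \<le> card {G \<in> ?S. excess n d G \<le> T} + (\<Sum>v\<in>{1..n}. card (?B v))"
    using card_Un_le card_UN_le[of "{1..n}" ?B] by (meson add_left_mono finite_atLeastAtMost order_trans)
  also have "card {G \<in> ?S. excess n d G \<le> T} \<le> ?R"
    using assms by (intro card_excess_le) auto
  finally have "card ?S \<le> ?R + (\<Sum>v\<in>{1..n}. card (?B v))" by simp
  then have "real (card ?S) \<le> real (?R + (\<Sum>v\<in>{1..n}. card (?B v)))"
    by (rule of_nat_mono)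
  then have "real (card ?S) \<le> real ?R + (\<Sum>v\<in>{1..n}. real (card (?B v)))"
    by (simp only: of_nat_add of_nat_sum)
  also have "(\<Sum>v\<in>{1..n}. real (card (?B v))) \<le>
      (\<Sum>v\<in>{1..n}. real (card ?S) * exp (- (t0\<^sup>2 / (4 * real n))))"
    using B by (rule sum_mono)
  also have "\<dots> = real (card ?S) * (real n * exp (- (t0\<^sup>2 / (4 * real n))))" by simp
  \<comment> \<open>The exceptional graphs are at most half of all and are absorbed on the left,
    which gives the factor 2.\<close>
  also have "\<dots> \<le> real (card ?S) * (1 / 2)"
    using assms(4) by (rule mult_left_mono) simp
  finally have "real (card ?S) \<le> 2 * real ?R" by simp
  also have "\<dots> = 2 * (real T + 1) * real n ^ (3 * T) * real (card (regular_graphs n d))"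
    by (simp add: algebra_simps)
  finally show ?thesis .
qed

section \<open>Upper bounds for edge counts between vertex sets\<close>

definition edges_between :: "nat set \<Rightarrow> nat set \<Rightarrow> graph" where
  "edges_between A B = {{x, y} | x y. x \<in> A \<and> y \<in> B \<and> x \<noteq> y}"

lemma edges_between_subset:
  assumes "A \<subseteq> {1..n}" "B \<subseteq> {1..n}"
  shows "edges_between A B \<subseteq> complete_edges n"
  using assms unfolding edges_between_def
  by (auto simp: doubleton_in_complete_edges simp del: atLeastAtMost_iff)

text \<open>One-sided on purpose: backward switchings need many non-edges and forward switchings few
  edges, and an upper bound on edge counts yields both.\<close>

definition upper_uniform :: "nat \<Rightarrow> nat \<Rightarrow> real \<Rightarrow> graph \<Rightarrow> bool" where
  "upper_uniform n d \<tau> G \<longleftrightarrow> (\<forall>A\<subseteq>{1..n}. \<forall>B\<subseteq>{1..n}.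
     real (card (G \<inter> edges_between A B)) \<le>
       real d / (real n - 1) * real (card (edges_between A B)) + \<tau>)"

text \<open>A union bound over the \<open>4 ^ n\<close> pairs of vertex sets, each with the Chernoff
  bound at scale \<open>L = n\<^sup>2\<close>.\<close>

lemma card_not_upper_uniform_le:
  assumes "2 * M = d * n" "n \<ge> 2" "0 \<le> \<tau>"
  shows "real (card {G \<in> sized_subsets (complete_edges n) M. \<not> upper_uniform n d \<tau> G}) \<le>
    4 ^ n * exp (- (\<tau>\<^sup>2 / (4 * (real n)\<^sup>2))) * real (card (sized_subsets (complete_edges n) M))"
proof -
  let ?E = "complete_edges n"
  let ?S = "sized_subsets ?E M"
  let ?P = "Pow {1..n} \<times> Pow {1..n}"
  let ?B = "\<lambda>(A, B). {G \<in> ?S. real (card (G \<inter> edges_between A B)) >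
    real M / real (card ?E) * real (card (edges_between A B)) + \<tau>}"
  have q: "real M / real (card ?E) = real d / (real n - 1)"
    using assms by (intro edge_density_eq) auto
  have "{G \<in> ?S. \<not> upper_uniform n d \<tau> G} \<subseteq> (\<Union>z\<in>?P. ?B z)"
    unfolding upper_uniform_def q by (auto simp: not_le)
  then have "card {G \<in> ?S. \<not> upper_uniform n d \<tau> G} \<le> card (\<Union>z\<in>?P. ?B z)"
    by (intro card_mono) auto
  also have "\<dots> \<le> (\<Sum>z\<in>?P. card (?B z))" by (rule card_UN_le) auto
  finally have "real (card {G \<in> ?S. \<not> upper_uniform n d \<tau> G}) \<le> real (\<Sum>z\<in>?P. card (?B z))"
    by (rule of_nat_mono)
  also have "\<dots> = (\<Sum>z\<in>?P. real (card (?B z)))" by (rule of_nat_sum)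
  also have "\<dots> \<le> (\<Sum>z\<in>?P. real (card ?S) * exp (- (\<tau>\<^sup>2 / (4 * (real n)\<^sup>2))))"
  proof (rule sum_mono)
    fix z assume "z \<in> ?P"
    then obtain A B where z: "z = (A, B)" "A \<subseteq> {1..n}" "B \<subseteq> {1..n}" by auto
    have sub: "edges_between A B \<subseteq> ?E" by (rule edges_between_subset[OF z(2,3)])
    then have "card (edges_between A B) \<le> card ?E" by (intro card_mono) auto
    then have "real (card (edges_between A B)) \<le> real n * (real n - 1) / 2"
      by (metis card_complete_edges of_nat_le_iff)
    also have "\<dots> \<le> (real n)\<^sup>2" by (simp add: power2_eq_square algebra_simps)
    finally have "real (card (edges_between A B)) \<le> (real n)\<^sup>2" .
    then show "real (card (?B z)) \<le> real (card ?S) * exp (- (\<tau>\<^sup>2 / (4 * (real n)\<^sup>2)))"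
      unfolding z(1) prod.case using assms sub by (intro card_sized_subsets_upper_tail) auto
  qed
  also have "\<dots> = real (card ?P) * (real (card ?S) * exp (- (\<tau>\<^sup>2 / (4 * (real n)\<^sup>2))))" by simp
  also have "real (card ?P) = 4 ^ n"
    by (simp add: card_cartesian_product card_Pow power_mult_distrib[symmetric])
  finally show ?thesis by (simp add: mult_ac)
qed

text \<open>Every bad regular graph is a bad graph with \<open>M\<close> edges; measuring their
  number against the regular graphs alone costs the ratio from
  \<open>card_sized_subsets_le_regular_graphs\<close>.\<close>

lemma card_regular_not_upper_uniform_le:
  fixes t0 :: real
  assumes "2 * M = d * n" "n \<ge> 2" "0 \<le> t0" "real n * exp (- (t0\<^sup>2 / (4 * real n))) \<le> 1 / 2" "0 \<le> \<tau>"
  defines "T \<equiv> nat \<lfloor>real n * t0\<rfloor>"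
  shows "real (card {G \<in> regular_graphs n d. \<not> upper_uniform n d \<tau> G}) \<le>
    4 ^ n * exp (- (\<tau>\<^sup>2 / (4 * (real n)\<^sup>2))) * (2 * (real T + 1) * real n ^ (3 * T)) *
    real (card (regular_graphs n d))"
proof -
  let ?S = "sized_subsets (complete_edges n) M"
  have "{G \<in> regular_graphs n d. \<not> upper_uniform n d \<tau> G} \<subseteq> {G \<in> ?S. \<not> upper_uniform n d \<tau> G}"
    using regular_graphs_eq_excess_0[OF assms(1)] by auto
  then have "real (card {G \<in> regular_graphs n d. \<not> upper_uniform n d \<tau> G}) \<le>
      real (card {G \<in> ?S. \<not> upper_uniform n d \<tau> G})"
    by (intro of_nat_mono card_mono) auto
  also have "\<dots> \<le> 4 ^ n * exp (- (\<tau>\<^sup>2 / (4 * (real n)\<^sup>2))) * real (card ?S)"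
    using assms by (intro card_not_upper_uniform_le) auto
  also have "\<dots> \<le> 4 ^ n * exp (- (\<tau>\<^sup>2 / (4 * (real n)\<^sup>2))) *
      (2 * (real T + 1) * real n ^ (3 * T) * real (card (regular_graphs n d)))"
    unfolding T_def using assms by (intro mult_left_mono card_sized_subsets_le_regular_graphs) auto
  finally show ?thesis by (simp add: mult_ac)
qed

text \<open>Existence follows from the comparison of counts: without regular graphs there would be
  no graph with \<open>M\<close> edges at all, although \<open>M\<close> is at most the number of
  pairs.\<close>

lemma regular_graphs_nonempty:
  fixes t0 :: real
  assumes "2 * M = d * n" "n \<ge> 2" "d < n" "0 \<le> t0" "real n * exp (- (t0\<^sup>2 / (4 * real n))) \<le> 1 / 2"
  shows "regular_graphs n d \<noteq> {}"
proof
  assume "regular_graphs n d = {}"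
  then have "real (card (sized_subsets (complete_edges n) M)) \<le> 0"
    using card_sized_subsets_le_regular_graphs[OF assms(1,2,4,5)] by simp
  moreover have "card (sized_subsets (complete_edges n) M) = card (complete_edges n) choose M"
    unfolding sized_subsets_def by (intro n_subsets) auto
  moreover have "M \<le> card (complete_edges n)"
  proof -
    have "2 * real M = real d * real n" using assms(1) by (metis of_nat_mult of_nat_numeral)
    also have "\<dots> \<le> (real n - 1) * real n" using assms(3) by (intro mult_right_mono) auto
    finally have "real M \<le> real (card (complete_edges n))" by (simp add: card_complete_edges mult.commute)
    then show ?thesis by simp
  qed
  ultimately show False by (simp add: not_less)
qed

text \<open>A pair inside \<open>A \<inter> B\<close> is counted in both orders, hence the second summand.\<close>

lemma card_ordered_pairs_in_graph:
  assumes "S \<subseteq> complete_edges n" "finite A" "finite B"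
  shows "card {(x, y). x \<in> A \<and> y \<in> B \<and> {x, y} \<in> S} =
    card (S \<inter> edges_between A B) + card (S \<inter> edges_between (A \<inter> B) (A \<inter> B))"
proof -
  \<comment> \<open>Ordered pairs are split by \<open>x < y\<close> and \<open>y < x\<close>. Both
    parts map injectively to edges, and an edge of \<open>S\<close> lies in both images exactly if
    its two ends are in \<open>A \<inter> B\<close>.\<close>
  let ?L = "{(x, y). x \<in> A \<and> y \<in> B \<and> {x, y} \<in> S \<and> x < y}"
  let ?U = "{(x, y). x \<in> A \<and> y \<in> B \<and> {x, y} \<in> S \<and> y < x}"
  let ?f = "\<lambda>(x, y). {x, y} :: nat set"
  have fin: "finite ?L" "finite ?U"
    by (rule finite_subset[of _ "A \<times> B"]; use assms in auto)+
  have "{x} \<notin> S" for x using assms(1) by (auto simp: complete_edges_def)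
  then have ne: "x \<noteq> y" if "{x, y} \<in> S" for x y using that by auto
  have "{(x, y). x \<in> A \<and> y \<in> B \<and> {x, y} \<in> S} = ?L \<union> ?U" using ne by force
  then have "card {(x, y). x \<in> A \<and> y \<in> B \<and> {x, y} \<in> S} = card ?L + card ?U"
    using fin by (simp only:) (intro card_Un_disjoint; auto)
  also have "card ?L = card (?f ` ?L)"
    by (intro card_image[symmetric]) (auto simp: inj_on_def doubleton_eq_iff)
  also have "card ?U = card (?f ` ?U)"
    by (intro card_image[symmetric]) (auto simp: inj_on_def doubleton_eq_iff)
  also have "card (?f ` ?L) + card (?f ` ?U) = card (?f ` ?L \<union> ?f ` ?U) + card (?f ` ?L \<inter> ?f ` ?U)"
    using fin by (intro card_Un_Int) auto
  also have "?f ` ?L \<union> ?f ` ?U = S \<inter> edges_between A B"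
  proof (intro set_eqI iffI)
    fix e assume "e \<in> S \<inter> edges_between A B"
    then obtain x y where "x \<in> A" "y \<in> B" "x \<noteq> y" "e = {x, y}" "e \<in> S"
      by (auto simp: edges_between_def)
    then show "e \<in> ?f ` ?L \<union> ?f ` ?U"
      by (cases "x < y") (auto intro!: image_eqI[of _ _ "(x, y)"])
  qed (auto simp: edges_between_def)
  also have "?f ` ?L \<inter> ?f ` ?U = S \<inter> edges_between (A \<inter> B) (A \<inter> B)"
  proof (intro set_eqI iffI)
    fix e assume "e \<in> ?f ` ?L \<inter> ?f ` ?U"
    then obtain x y x' y' where "x \<in> A" "y \<in> B" "x < y" "e = {x, y}" "e \<in> S"
      "x' \<in> A" "y' \<in> B" "y' < x'" "e = {x', y'}" by auto
    moreover from this have "x' = y" "y' = x" by (auto simp: doubleton_eq_iff)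
    ultimately show "e \<in> S \<inter> edges_between (A \<inter> B) (A \<inter> B)"
      by (auto simp: edges_between_def)
  next
    fix e assume "e \<in> S \<inter> edges_between (A \<inter> B) (A \<inter> B)"
    then obtain x y where "x \<in> A \<inter> B" "y \<in> A \<inter> B" "x \<noteq> y" "e = {x, y}" "e \<in> S"
      by (auto simp: edges_between_def)
    then obtain a b where "a \<in> A \<inter> B" "b \<in> A \<inter> B" "a < b" "e = {a, b}" "e \<in> S"
      by (metis insert_commute linorder_neqE_nat)
    then have "(a, b) \<in> ?L" "(b, a) \<in> ?U" "e = ?f (a, b)" "e = ?f (b, a)"
      by (auto simp: insert_commute)
    then show "e \<in> ?f ` ?L \<inter> ?f ` ?U" by blast
  qed
  finally show ?thesis .
qed

text \<open>The identity for ordered pairs, applied to the complete graph.\<close>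

lemma card_edges_between_le:
  assumes "A \<subseteq> {1..n}" "B \<subseteq> {1..n}"
  shows "card (edges_between A B) + card (edges_between (A \<inter> B) (A \<inter> B)) \<le> card A * card B"
proof -
  have fin: "finite A" "finite B" using assms finite_subset by auto
  have "A \<inter> B \<subseteq> {1..n}" using assms by auto
  then have "complete_edges n \<inter> edges_between A B = edges_between A B"
    "complete_edges n \<inter> edges_between (A \<inter> B) (A \<inter> B) = edges_between (A \<inter> B) (A \<inter> B)"
    using edges_between_subset assms by blast+
  then have "card (edges_between A B) + card (edges_between (A \<inter> B) (A \<inter> B)) =
      card {(x, y). x \<in> A \<and> y \<in> B \<and> {x, y} \<in> complete_edges n}"
    using card_ordered_pairs_in_graph[OF order_refl fin, of n] by simp
  also have "\<dots> \<le> card (A \<times> B)" using fin by (intro card_mono) auto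
  finally show ?thesis by (simp add: card_cartesian_product)
qed

text \<open>Upper uniformity is applied twice, to \<open>A\<close> and \<open>B\<close> and to
  \<open>A \<inter> B\<close> with itself, hence the error \<open>2 * \<tau>\<close>.\<close>

lemma upper_uniform_ordered_pairs:
  assumes "upper_uniform n d \<tau> G" "G \<subseteq> complete_edges n" "n \<ge> 2" "A \<subseteq> {1..n}" "B \<subseteq> {1..n}"
  shows "real (card (G \<inter> edges_between A B)) + real (card (G \<inter> edges_between (A \<inter> B) (A \<inter> B)))
      \<le> real d / (real n - 1) * (real (card A) * real (card B)) + 2 * \<tau>"
proof -
  let ?q = "real d / (real n - 1)"
  let ?a = "card (edges_between A B)" and ?b = "card (edges_between (A \<inter> B) (A \<inter> B))"
  have "A \<inter> B \<subseteq> {1..n}" using assms by auto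
  then have "real (card (G \<inter> edges_between A B)) + real (card (G \<inter> edges_between (A \<inter> B) (A \<inter> B)))
      \<le> (?q * real ?a + \<tau>) + (?q * real ?b + \<tau>)"
    using assms unfolding upper_uniform_def by (intro add_mono) auto
  also have "\<dots> = ?q * real (?a + ?b) + 2 * \<tau>" by (simp add: algebra_simps)
  also have "?q * real (?a + ?b) \<le> ?q * real (card A * card B)"
    using card_edges_between_le[OF assms(4,5)] assms(3) by (intro mult_left_mono of_nat_mono) auto
  finally show ?thesis by simp
qed

section \<open>Switchings\<close>

text \<open>A pair \<open>(x, y)\<close> stands for the exchange of \<open>{ux, vy}\<close> (edges of \<open>G\<close> when \<open>uv\<close> is not an
  edge) with \<open>{uv, xy}\<close>; no edge of \<open>h\<close> is ever removed.\<close>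

definition backward_switchings :: "nat \<Rightarrow> nat \<Rightarrow> nat \<Rightarrow> graph \<Rightarrow> graph \<Rightarrow> (nat \<times> nat) set" where
  "backward_switchings n u v G h = {(x, y). x \<in> {1..n} \<and> y \<in> {1..n} \<and>
     {u, x} \<in> G - h \<and> {v, y} \<in> G - h \<and> x \<noteq> y \<and> {x, y} \<notin> G}"

definition forward_switchings :: "nat \<Rightarrow> nat \<Rightarrow> nat \<Rightarrow> graph \<Rightarrow> graph \<Rightarrow> (nat \<times> nat) set" where
  "forward_switchings n u v G h = {(x, y). x \<in> {1..n} \<and> y \<in> {1..n} \<and>
     {x, y} \<in> G - {{u, v}} - h \<and> x \<noteq> u \<and> y \<noteq> v \<and> {u, x} \<notin> G \<and> {v, y} \<notin> G}"

lemma finite_backward_switchings [simp]: "finite (backward_switchings n u v G h)"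
  by (rule finite_subset[of _ "{1..n} \<times> {1..n}"]) (auto simp: backward_switchings_def)

lemma finite_forward_switchings [simp]: "finite (forward_switchings n u v G h)"
  by (rule finite_subset[of _ "{1..n} \<times> {1..n}"]) (auto simp: forward_switchings_def)

lemma card_forward_switchings_le: "card (forward_switchings n u v G h) \<le> n\<^sup>2"
proof -
  have "card (forward_switchings n u v G h) \<le> card ({1..n} \<times> {1..n})"
    by (rule card_mono) (auto simp: forward_switchings_def)
  then show ?thesis by (simp add: card_cartesian_product power2_eq_square)
qed

lemma finite_regular_graphs [simp]: "finite (regular_graphs n d)"
  by (rule finite_subset[of _ "Pow (complete_edges n)"]) (auto simp: regular_graphs_def)

text \<open>The switching is two successive edge replacements; each of the four distinct vertices
  \<open>u\<close>, \<open>v\<close>, \<open>x\<close>, \<open>y\<close> loses one edge and gains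
  one. The last conclusion inverts it once \<open>x\<close> and \<open>y\<close> are known.\<close>

lemma switch_regular:
  assumes G: "G \<in> regular_graphs n d" and uv: "u \<in> {1..n}" "v \<in> {1..n}" "u \<noteq> v" "{u, v} \<notin> G"
    and xy: "(x, y) \<in> backward_switchings n u v G h" and h: "h \<subseteq> G" "{u, v} \<notin> h"
  defines "G' \<equiv> insert {x, y} (insert {u, v} (G - {{u, x}}) - {{v, y}})"
  shows "G' \<in> regular_graphs n d" "{u, v} \<in> G'" "h \<subseteq> G'" "(x, y) \<in> forward_switchings n u v G' h"
    "G = insert {v, y} (insert {u, x} (G' - {{x, y}}) - {{u, v}})"
proof -
  have GE: "G \<subseteq> complete_edges n" and deg: "\<And>w. w \<in> {1..n} \<Longrightarrow> degree G w = d"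
    using G by (auto simp: regular_graphs_def)
  have fin: "finite G" using GE by (rule finite_subset_complete_edges)
  have notself: "{z} \<notin> G" for z using GE by (auto simp: complete_edges_def)
  have x: "x \<in> {1..n}" "y \<in> {1..n}" "{u, x} \<in> G" "{v, y} \<in> G" "{u, x} \<notin> h" "{v, y} \<notin> h"
    "x \<noteq> y" "{x, y} \<notin> G" using xy by (auto simp: backward_switchings_def)
  have "{v, u} \<notin> G" using uv(4) by (simp add: insert_commute)
  \<comment> \<open>Otherwise \<open>ux\<close> or \<open>vy\<close> would be a singleton or the
    pair \<open>uv\<close>, and neither is an edge.\<close>
  then have ne: "x \<noteq> u" "x \<noteq> v" "y \<noteq> u" "y \<noteq> v"
    using x(3,4) uv(4) notself by auto
  have neq: "{v, y} \<noteq> {u, x}" "{x, y} \<noteq> {u, v}" "{u, v} \<noteq> {u, x}" "{u, v} \<noteq> {v, y}"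
    "{x, y} \<noteq> {u, x}" "{x, y} \<noteq> {v, y}"
    using ne uv(3) x(7) by (auto simp: doubleton_eq_iff)
  define G2 where "G2 = insert {u, v} (G - {{u, x}})"
  have G2: "finite G2" "{v, y} \<in> G2" "{x, y} \<notin> G2"
    using fin x neq by (auto simp: G2_def)
  have G'2: "G' = insert {x, y} (G2 - {{v, y}})" by (simp add: G'_def G2_def)
  have "degree G' w = degree G w" for w
  proof -
    have "degree G2 w + of_bool (w \<in> {u, x}) = degree G w + of_bool (w \<in> {u, v})"
      unfolding G2_def by (rule degree_replace_edge[OF fin x(3) uv(4)])
    moreover have "degree G' w + of_bool (w \<in> {v, y}) = degree G2 w + of_bool (w \<in> {x, y})"
      unfolding G'2 by (rule degree_replace_edge[OF G2])
    moreover have "of_bool (w \<in> {u, v}) + of_bool (w \<in> {x, y}) =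
        of_bool (w \<in> {u, x}) + (of_bool (w \<in> {v, y}) :: nat)"
      using ne uv(3) x(7) by auto
    ultimately show ?thesis by linarith
  qed
  moreover have "{u, v} \<in> complete_edges n" "{x, y} \<in> complete_edges n"
    using uv x by (simp_all add: doubleton_in_complete_edges)
  then have "G' \<subseteq> complete_edges n" using GE by (auto simp: G'_def)
  ultimately show "G' \<in> regular_graphs n d" using deg by (simp add: regular_graphs_def)
  show "{u, v} \<in> G'" using neq by (simp add: G'_def)
  show "h \<subseteq> G'" using h(1) x by (auto simp: G'_def)
  show "(x, y) \<in> forward_switchings n u v G' h"
    using x ne neq uv h by (auto simp: forward_switchings_def G'_def)
  show "G = insert {v, y} (insert {u, x} (G' - {{x, y}}) - {{u, v}})"
    using x neq uv(4) by (auto simp: G'_def)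
qed

text \<open>Double counting: a graph with a pair \<open>(x, y)\<close> is sent to the switched graph
  with the same pair, and since the switching can be undone this map is injective.\<close>

lemma sum_backward_le_sum_forward:
  assumes uv: "u \<in> {1..n}" "v \<in> {1..n}" "u \<noteq> v" and h: "{u, v} \<notin> h"
  shows "(\<Sum>G\<in>{G \<in> regular_graphs n d. h \<subseteq> G \<and> {u, v} \<notin> G}. card (backward_switchings n u v G h))
    \<le> (\<Sum>G\<in>{G \<in> regular_graphs n d. h \<subseteq> G \<and> {u, v} \<in> G}. card (forward_switchings n u v G h))"
proof -
  let ?P = "{G \<in> regular_graphs n d. h \<subseteq> G \<and> {u, v} \<notin> G}"
  let ?Q = "{G \<in> regular_graphs n d. h \<subseteq> G \<and> {u, v} \<in> G}"
  let ?b = "\<lambda>G. backward_switchings n u v G h" and ?f = "\<lambda>G. forward_switchings n u v G h"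
  define sw where "sw z = (insert {fst (snd z), snd (snd z)}
      (insert {u, v} (fst z - {{u, fst (snd z)}}) - {{v, snd (snd z)}}), snd z)"
    for z :: "graph \<times> nat \<times> nat"
  have "card (Sigma ?P ?b) \<le> card (Sigma ?Q ?f)"
  proof (rule card_inj_on_le[of sw])
    have recover: "fst z = insert {v, snd (snd z)}
        (insert {u, fst (snd z)} (fst (sw z) - {{fst (snd z), snd (snd z)}}) - {{u, v}})"
      if z: "z \<in> Sigma ?P ?b" for z
    proof -
      obtain G x y where Gxy: "z = (G, x, y)" by (metis surj_pair)
      then have G: "G \<in> regular_graphs n d" "h \<subseteq> G" "{u, v} \<notin> G" and xy: "(x, y) \<in> ?b G"
        using z by auto
      show ?thesis
        unfolding Gxy sw_def fst_conv snd_conv by (rule switch_regular(5)[OF G(1) uv G(3) xy G(2) h])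
    qed
    show "inj_on sw (Sigma ?P ?b)"
    proof (rule inj_onI)
      fix z z' assume z: "z \<in> Sigma ?P ?b" "z' \<in> Sigma ?P ?b" "sw z = sw z'"
      have "snd z = snd z'" using z(3) by (simp add: sw_def)
      then have "fst z = fst z'" using recover[OF z(1)] recover[OF z(2)] z(3) by simp
      then show "z = z'" using \<open>snd z = snd z'\<close> by (rule prod_eqI)
    qed
    show "sw ` Sigma ?P ?b \<subseteq> Sigma ?Q ?f"
    proof
      fix w assume "w \<in> sw ` Sigma ?P ?b"
      then obtain G x y where w: "w = sw (G, x, y)" and G: "G \<in> regular_graphs n d" "h \<subseteq> G" "{u, v} \<notin> G"
        and xy: "(x, y) \<in> ?b G" by auto
      from switch_regular(1-4)[OF G(1) uv G(3) xy G(2) h]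
      show "w \<in> Sigma ?Q ?f" by (simp add: w sw_def)
    qed
  qed auto
  then show ?thesis by (simp add: card_SigmaI)
qed

section \<open>Thinned regular graphs and the conditional probability of an edge\<close>

text \<open>All regular graphs have \<open>M\<close> edges, so the weight of \<open>h\<close> is the
  same for every \<open>G\<close> above it. The quotient of powers keeps the formula valid for
  \<open>card h > M\<close>, where the count is 0.\<close>

lemma pmf_thinned_regular_graph:
  assumes "regular_graphs n d \<noteq> {}" "2 * M = d * n" "0 < \<xi>" "\<xi> < 1"
  shows "pmf (bind_pmf (pmf_of_set (regular_graphs n d)) (\<lambda>G. random_subset G (1 - \<xi>))) h =
    (1 - \<xi>) ^ card h * \<xi> ^ M / \<xi> ^ card h *
      real (card {G \<in> regular_graphs n d. h \<subseteq> G}) / real (card (regular_graphs n d))"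
proof -
  let ?R = "regular_graphs n d"
  let ?c = "(1 - \<xi>) ^ card h * \<xi> ^ M / \<xi> ^ card h"
  have "pmf (random_subset G (1 - \<xi>)) h = (if h \<subseteq> G then ?c else 0)" if "G \<in> ?R" for G
  proof -
    have G: "G \<subseteq> complete_edges n" "card G = M"
      using that regular_graphs_eq_excess_0[OF assms(2)] by (auto simp: sized_subsets_def)
    have fin: "finite G" using G(1) by (rule finite_subset_complete_edges)
    show ?thesis
    proof (cases "h \<subseteq> G")
      case True
      then have "card (G - h) = M - card h" "card h \<le> M"
        using G fin by (auto simp: card_Diff_subset finite_subset card_mono)
      then show ?thesis using True fin assms
        by (simp add: pmf_random_subset power_diff)
    next
      case False
      then have "h \<notin> set_pmf (random_subset G (1 - \<xi>))"
        using set_pmf_random_subset[OF fin] by blast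
      then show ?thesis using False by (simp add: set_pmf_iff)
    qed
  qed
  then have "(\<Sum>G\<in>?R. pmf (random_subset G (1 - \<xi>)) h) = (\<Sum>G\<in>?R. if h \<subseteq> G then ?c else 0)"
    by (intro sum.cong) auto
  also have "\<dots> = ?c * real (card {G \<in> ?R. h \<subseteq> G})"
    by (simp add: sum.inter_filter[symmetric])
  finally show ?thesis
    using assms(1) by (simp add: pmf_bind integral_pmf_of_set)
qed

lemma prob_random_subset_eq_sum:
  assumes "finite K" "0 \<le> r" "r \<le> 1"
  shows "measure_pmf.prob (random_subset K r) {h. P h} =
    (\<Sum>h\<in>{h \<in> Pow K. P h}. r ^ card h * (1 - r) ^ card (K - h))"
proof -
  have "measure_pmf.prob (random_subset K r) {h. P h} =
      measure_pmf.prob (random_subset K r) {h \<in> Pow K. P h}"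
    using set_pmf_random_subset[OF assms(1), of r]
    by (intro measure_pmf.finite_measure_eq_AE) (auto simp: AE_measure_pmf_iff)
  also have "\<dots> = (\<Sum>h\<in>{h \<in> Pow K. P h}. pmf (random_subset K r) h)"
    using assms by (intro measure_measure_pmf_finite) auto
  also have "\<dots> = (\<Sum>h\<in>{h \<in> Pow K. P h}. r ^ card h * (1 - r) ^ card (K - h))"
    using assms by (intro sum.cong) (auto simp: pmf_random_subset)
  finally show ?thesis .
qed

lemma sum_weight_count:
  fixes c :: "'a \<Rightarrow> real"
  assumes "finite H" "finite R"
  shows "(\<Sum>h\<in>H. c h * real (card {G \<in> R. P G h})) = (\<Sum>G\<in>R. \<Sum>h\<in>{h \<in> H. P G h}. c h)"
proof -
  have "(\<Sum>h\<in>H. c h * real (card {G \<in> R. P G h})) = (\<Sum>h\<in>H. \<Sum>G\<in>R. if P G h then c h else 0)"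
    using assms by (simp add: sum.inter_filter[symmetric] mult.commute)
  also have "\<dots> = (\<Sum>G\<in>R. \<Sum>h\<in>H. if P G h then c h else 0)" by (rule sum.swap)
  finally show ?thesis using assms by (simp add: sum.inter_filter)
qed

text \<open>For fixed \<open>h\<close>, double counting of switchings compares the regular graphs above \<open>h\<close> with and
  without the edge \<open>uv\<close>. Graphs with atypically few or many switchings are not excluded but moved
  into the error term, where summation over \<open>h\<close> turns them back into probabilities.\<close>

lemma deficiency_le:
  fixes p \<xi> b0 f0 :: real
  assumes R: "regular_graphs n d \<noteq> {}" and M: "2 * M = d * n"
    and \<xi>: "0 < \<xi>" "\<xi> < 1" and p: "0 \<le> p" "p \<le> 1" and b0: "1 \<le> b0" and f0: "0 \<le> f0"
    and key: "p * \<xi> * f0 \<le> (1 - \<xi> - p) * b0"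
    and uv: "u \<in> {1..n}" "v \<in> {1..n}" "u \<noteq> v"
  defines "\<mu> \<equiv> bind_pmf (pmf_of_set (regular_graphs n d)) (\<lambda>G. random_subset G (1 - \<xi>))"
  shows "(\<Sum>h\<in>Pow (complete_edges n - {{u, v}}).
      max 0 (p * (pmf \<mu> h + pmf \<mu> (insert {u, v} h)) - pmf \<mu> (insert {u, v} h))) \<le>
    ((\<Sum>G\<in>{G \<in> regular_graphs n d. {u, v} \<notin> G}. measure_pmf.prob (random_subset G (1 - \<xi>))
        {h. real (card (backward_switchings n u v G h)) < b0}) +
     (real n)\<^sup>2 * (\<Sum>G\<in>{G \<in> regular_graphs n d. {u, v} \<in> G}.
        measure_pmf.prob (random_subset (G - {{u, v}}) (1 - \<xi>))
        {h. real (card (forward_switchings n u v G h)) > f0})) / real (card (regular_graphs n d))"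
proof -
  let ?R = "regular_graphs n d" and ?e = "{u, v}"
  let ?H = "Pow (complete_edges n - {?e})"
  let ?b = "\<lambda>G h. real (card (backward_switchings n u v G h))"
  let ?f = "\<lambda>G h. real (card (forward_switchings n u v G h))"
  define r where "r = real (card ?R)"
  have r: "r > 0" using R by (simp add: r_def card_gt_0_iff)
  \<comment> \<open>The probability that thinning one fixed regular graph above \<open>h\<close>
    yields \<open>h\<close>.\<close>
  define c where "c h = (1 - \<xi>) ^ card h * \<xi> ^ M / \<xi> ^ card h" for h :: graph
  have c: "c h \<ge> 0" for h using \<xi> by (simp add: c_def)
  define RA where "RA h = {G \<in> ?R. h \<subseteq> G \<and> ?e \<in> G}" for h
  define RB where "RB h = {G \<in> ?R. h \<subseteq> G \<and> ?e \<notin> G}" for h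
  define RA' where "RA' h = {G \<in> ?R. ?e \<in> G \<and> h \<subseteq> G \<and> ?f G h > f0}" for h
  define RB' where "RB' h = {G \<in> ?R. ?e \<notin> G \<and> h \<subseteq> G \<and> ?b G h < b0}" for h
  have fin: "finite (RA h)" "finite (RB h)" "finite (RA' h)" "finite (RB' h)" for h
    by (simp_all add: RA_def RB_def RA'_def RB'_def)
  have summand: "max 0 (p * (pmf \<mu> h + pmf \<mu> (insert ?e h)) - pmf \<mu> (insert ?e h)) \<le>
      (c h * real (card (RB' h)) + (real n)\<^sup>2 * (c h / \<xi> * real (card (RA' h)))) / r"
    if h: "h \<in> ?H" for h
  proof -
    have eh: "?e \<notin> h" "finite h" using h finite_subset_complete_edges by auto
    have "card (RA h) + card (RB h) = card (RA h \<union> RB h)"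
      using fin by (intro card_Un_disjoint[symmetric]) (auto simp: RA_def RB_def)
    also have "RA h \<union> RB h = {G \<in> ?R. h \<subseteq> G}" by (auto simp: RA_def RB_def)
    finally have cnt: "real (card {G \<in> ?R. h \<subseteq> G}) = real (card (RA h)) + real (card (RB h))"
      by linarith
    have mu1: "pmf \<mu> h = c h * (real (card (RA h)) + real (card (RB h))) / r"
      unfolding \<mu>_def pmf_thinned_regular_graph[OF R M \<xi>] cnt by (simp add: c_def r_def)
    have "{G \<in> ?R. insert ?e h \<subseteq> G} = RA h" by (auto simp: RA_def)
    then have mu2: "pmf \<mu> (insert ?e h) = c h * (1 - \<xi>) / \<xi> * real (card (RA h)) / r"
      unfolding \<mu>_def pmf_thinned_regular_graph[OF R M \<xi>] using eh
      by (simp add: c_def r_def mult_ac)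
    let ?A = "real (card (RA h))" and ?B = "real (card (RB h))"
      and ?A' = "real (card (RA' h))" and ?B' = "real (card (RB' h))"
    \<comment> \<open>Typical graphs in \<open>RB h\<close> have at least \<open>b0\<close> backward
      switchings, typical graphs in \<open>RA h\<close> at most \<open>f0\<close> forward ones, and
      atypical graphs in \<open>RA h\<close> at most \<open>n\<^sup>2\<close>.\<close>
    have "b0 * (?B - ?B') \<le> (\<Sum>G\<in>RB h - RB' h. ?b G h)"
    proof -
      have "RB' h \<subseteq> RB h" by (auto simp: RB_def RB'_def)
      then have "real (card (RB h - RB' h)) = ?B - ?B'"
        using fin by (simp add: card_Diff_subset of_nat_diff card_mono)
      moreover have "real (card (RB h - RB' h)) * b0 \<le> (\<Sum>G\<in>RB h - RB' h. ?b G h)"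
        by (rule sum_bounded_below) (auto simp: RB_def RB'_def not_less)
      ultimately show ?thesis by (simp add: mult.commute)
    qed
    also have "\<dots> \<le> (\<Sum>G\<in>RB h. ?b G h)" using fin by (intro sum_mono2) auto
    also have "\<dots> \<le> (\<Sum>G\<in>RA h. ?f G h)"
      using sum_backward_le_sum_forward[OF uv eh(1), of d]
      unfolding RA_def RB_def by (simp only: of_nat_sum[symmetric] of_nat_le_iff)
    also have "\<dots> = (\<Sum>G\<in>RA h - RA' h. ?f G h) + (\<Sum>G\<in>RA' h. ?f G h)"
      using fin by (intro sum.subset_diff) (auto simp: RA_def RA'_def)
    also have "(\<Sum>G\<in>RA h - RA' h. ?f G h) \<le> (\<Sum>G\<in>RA h - RA' h. f0)"
      by (intro sum_mono) (auto simp: RA_def RA'_def not_less)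
    also have "\<dots> \<le> (\<Sum>G\<in>RA h. f0)" using fin f0 by (intro sum_mono2) auto
    also have "(\<Sum>G\<in>RA' h. ?f G h) \<le> (\<Sum>G\<in>RA' h. (real n)\<^sup>2)"
      using of_nat_mono[OF card_forward_switchings_le[of n u v _ h], where ?'a = real]
      by (intro sum_mono) simp
    finally have sw: "b0 * (?B - ?B') \<le> ?A * f0 + ?A' * (real n)\<^sup>2" by simp
    \<comment> \<open>After clearing denominators, the conditional probability of \<open>?e\<close>
      falls short of \<open>p\<close> exactly by the excess of \<open>p * \<xi> * ?B\<close> over
      \<open>(1 - \<xi> - p) * ?A\<close>, up to a positive factor. By \<open>key\<close> only
      atypical graphs contribute to this excess.\<close>
    have "p * \<xi> * ?B \<le> p * \<xi> * ?B' + p * \<xi> / b0 * (?A * f0 + ?A' * (real n)\<^sup>2)"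
    proof -
      have "p * \<xi> / b0 * (b0 * (?B - ?B')) \<le> p * \<xi> / b0 * (?A * f0 + ?A' * (real n)\<^sup>2)"
        using sw p \<xi> b0 by (intro mult_left_mono) auto
      moreover have "p * \<xi> / b0 * (b0 * (?B - ?B')) = p * \<xi> * (?B - ?B')" using b0 by simp
      ultimately show ?thesis by (simp add: right_diff_distrib)
    qed
    also have "p * \<xi> * ?B' \<le> 1 * \<xi> * ?B'"
      using p \<xi> by (intro mult_right_mono) auto
    also have "p * \<xi> / b0 * (?A * f0 + ?A' * (real n)\<^sup>2) =
        p * \<xi> * f0 / b0 * ?A + p * \<xi> / b0 * (?A' * (real n)\<^sup>2)"
      by (simp add: algebra_simps add_divide_distrib)
    also have "p * \<xi> * f0 / b0 * ?A \<le> (1 - \<xi> - p) * ?A"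
      using key b0 by (intro mult_right_mono) (auto simp: divide_le_eq)
    also have "p * \<xi> / b0 * (?A' * (real n)\<^sup>2) \<le> 1 * (?A' * (real n)\<^sup>2)"
    proof (intro mult_right_mono)
      have "p * \<xi> \<le> 1 * 1" using p \<xi> by (intro mult_mono) auto
      then show "p * \<xi> / b0 \<le> 1" using b0 by (simp add: divide_le_eq)
    qed simp
    finally have main: "p * \<xi> * ?B - (1 - \<xi> - p) * ?A \<le> \<xi> * ?B' + ?A' * (real n)\<^sup>2" by simp
    have "p * (pmf \<mu> h + pmf \<mu> (insert ?e h)) - pmf \<mu> (insert ?e h) =
        c h / (\<xi> * r) * (p * \<xi> * ?B - (1 - \<xi> - p) * ?A)"
      unfolding mu1 mu2 using \<xi> r by (simp add: field_simps)
    also have "\<dots> \<le> c h / (\<xi> * r) * (\<xi> * ?B' + ?A' * (real n)\<^sup>2)"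
      using main c[of h] \<xi> r by (intro mult_left_mono) auto
    also have "\<dots> = (c h * ?B' + (real n)\<^sup>2 * (c h / \<xi> * ?A')) / r"
      using \<xi> r by (simp add: field_simps)
    finally have "p * (pmf \<mu> h + pmf \<mu> (insert ?e h)) - pmf \<mu> (insert ?e h) \<le>
      (c h * ?B' + (real n)\<^sup>2 * (c h / \<xi> * ?A')) / r" .
    moreover have "0 \<le> (c h * ?B' + (real n)\<^sup>2 * (c h / \<xi> * ?A')) / r"
      using c[of h] \<xi> r by simp
    ultimately show ?thesis by simp
  qed
  have finH: "finite ?H" by simp
  have card_G: "G \<subseteq> complete_edges n" "finite G" "card G = M" if "G \<in> ?R" for G
    using that regular_graphs_eq_excess_0[OF M] finite_subset_complete_edges
    by (auto simp: sized_subsets_def)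
  \<comment> \<open>For \<open>G\<close> without \<open>?e\<close> the weights \<open>c h\<close>
    are the probabilities in the thinning of \<open>G\<close>, so swapping the sums gives the
    probability of few switchings.\<close>
  have sumB: "(\<Sum>h\<in>?H. c h * real (card (RB' h))) =
      (\<Sum>G\<in>{G \<in> ?R. ?e \<notin> G}. measure_pmf.prob (random_subset G (1 - \<xi>)) {h. ?b G h < b0})"
  proof -
    have "(\<Sum>h\<in>?H. c h * real (card (RB' h))) =
        (\<Sum>G\<in>?R. \<Sum>h\<in>{h \<in> ?H. ?e \<notin> G \<and> h \<subseteq> G \<and> ?b G h < b0}. c h)"
      unfolding RB'_def by (rule sum_weight_count) auto
    also have "\<dots> = (\<Sum>G\<in>?R. if ?e \<notin> G then
        measure_pmf.prob (random_subset G (1 - \<xi>)) {h. ?b G h < b0} else 0)"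
    proof (rule sum.cong[OF refl])
      fix G assume G: "G \<in> ?R"
      show "(\<Sum>h\<in>{h \<in> ?H. ?e \<notin> G \<and> h \<subseteq> G \<and> ?b G h < b0}. c h) = (if ?e \<notin> G then
        measure_pmf.prob (random_subset G (1 - \<xi>)) {h. ?b G h < b0} else 0)"
      proof (cases "?e \<in> G")
        case False
        have "{h \<in> ?H. ?e \<notin> G \<and> h \<subseteq> G \<and> ?b G h < b0} = {h \<in> Pow G. ?b G h < b0}"
          using card_G(1)[OF G] False by blast
        moreover have "c h = (1 - \<xi>) ^ card h * (1 - (1 - \<xi>)) ^ card (G - h)" if "h \<subseteq> G" for h
          using that card_G[OF G] \<xi> card_mono[of G h]
          by (simp add: c_def card_Diff_subset finite_subset power_diff)
        ultimately show ?thesis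
          using False \<xi> card_G(2)[OF G] by (simp add: prob_random_subset_eq_sum)
      next
        case True
        then have "{h \<in> ?H. ?e \<notin> G \<and> h \<subseteq> G \<and> ?b G h < b0} = {}" by blast
        then show ?thesis using True by (simp only: sum.empty if_False not_True_eq_False)
      qed
    qed
    finally show ?thesis by (simp add: sum.inter_filter)
  qed
  \<comment> \<open>Here \<open>?e\<close> lies in \<open>G\<close> but not in \<open>h\<close>; the
    factor \<open>1 / \<xi>\<close> turns \<open>c h\<close> into the weight of \<open>h\<close> in
    the thinning of \<open>G - {?e}\<close>, which has \<open>M - 1\<close> edges.\<close>
  have sumA: "(\<Sum>h\<in>?H. c h / \<xi> * real (card (RA' h))) =
      (\<Sum>G\<in>{G \<in> ?R. ?e \<in> G}. measure_pmf.prob (random_subset (G - {?e}) (1 - \<xi>)) {h. ?f G h > f0})"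
  proof -
    have "(\<Sum>h\<in>?H. c h / \<xi> * real (card (RA' h))) =
        (\<Sum>G\<in>?R. \<Sum>h\<in>{h \<in> ?H. ?e \<in> G \<and> h \<subseteq> G \<and> ?f G h > f0}. c h / \<xi>)"
      unfolding RA'_def by (rule sum_weight_count) auto
    also have "\<dots> = (\<Sum>G\<in>?R. if ?e \<in> G then
        measure_pmf.prob (random_subset (G - {?e}) (1 - \<xi>)) {h. ?f G h > f0} else 0)"
    proof (rule sum.cong[OF refl])
      fix G assume G: "G \<in> ?R"
      show "(\<Sum>h\<in>{h \<in> ?H. ?e \<in> G \<and> h \<subseteq> G \<and> ?f G h > f0}. c h / \<xi>) = (if ?e \<in> G then
        measure_pmf.prob (random_subset (G - {?e}) (1 - \<xi>)) {h. ?f G h > f0} else 0)"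
      proof (cases "?e \<in> G")
        case True
        let ?K = "G - {?e}"
        have "{h \<in> ?H. ?e \<in> G \<and> h \<subseteq> G \<and> ?f G h > f0} = {h \<in> Pow ?K. ?f G h > f0}"
          using card_G(1)[OF G] True by blast
        moreover have "c h / \<xi> = (1 - \<xi>) ^ card h * (1 - (1 - \<xi>)) ^ card (?K - h)" if "h \<subseteq> ?K" for h
        proof -
          have K: "finite ?K" "Suc (card ?K) = M"
            using card_G[OF G] True card_Suc_Diff1[of G ?e] by auto
          have le: "card h \<le> card ?K" by (rule card_mono[OF K(1) that])
          have "card (?K - h) = card ?K - card h"
            using that K(1) by (intro card_Diff_subset finite_subset[OF that]) auto
          then show ?thesis
            using le \<xi> by (simp add: c_def K(2)[symmetric] power_diff)
        qed
        ultimately show ?thesis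
          using True \<xi> card_G(2)[OF G] by (simp add: prob_random_subset_eq_sum)
      next
        case False
        then have "{h \<in> ?H. ?e \<in> G \<and> h \<subseteq> G \<and> ?f G h > f0} = {}" by blast
        then show ?thesis using False by (simp only: sum.empty if_False)
      qed
    qed
    finally show ?thesis by (simp add: sum.inter_filter)
  qed
  have "(\<Sum>h\<in>?H. max 0 (p * (pmf \<mu> h + pmf \<mu> (insert ?e h)) - pmf \<mu> (insert ?e h))) \<le>
      (\<Sum>h\<in>?H. (c h * real (card (RB' h)) + (real n)\<^sup>2 * (c h / \<xi> * real (card (RA' h)))) / r)"
    using summand by (rule sum_mono)
  also have "\<dots> = ((\<Sum>h\<in>?H. c h * real (card (RB' h))) +
      (real n)\<^sup>2 * (\<Sum>h\<in>?H. c h / \<xi> * real (card (RA' h)))) / r"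
    by (simp only: sum_divide_distrib[symmetric] sum.distrib sum_distrib_left)
  finally show ?thesis unfolding sumA sumB r_def .
qed

section \<open>Typical numbers of switchings\<close>

text \<open>Unless too many edges are retained at \<open>u\<close> or at \<open>v\<close>, each of
  them loses at least \<open>\<xi> * d - s\<close> edges. By upper uniformity a proportion of about
  \<open>1 - d / (n - 1)\<close> of the pairs between the two lost neighbourhoods are non-edges;
  \<open>n\<close> pays for the pairs with \<open>x = y\<close> and \<open>2 * \<tau>\<close> for
  the error.\<close>

lemma prob_few_backward_switchings_le:
  fixes \<tau> s \<xi> :: real
  assumes G: "G \<in> regular_graphs n d" "upper_uniform n d \<tau> G"
    and n: "n \<ge> 2" "d < n" and \<xi>: "0 < \<xi>" "\<xi> < 1" and s: "0 \<le> s" "s \<le> \<xi> * real d"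
    and uv: "u \<in> {1..n}" "v \<in> {1..n}"
  shows "measure_pmf.prob (random_subset G (1 - \<xi>))
      {h. real (card (backward_switchings n u v G h)) <
        (1 - real d / (real n - 1)) * (\<xi> * real d - s)\<^sup>2 - real n - 2 * \<tau>} \<le>
    2 * exp (- (s\<^sup>2 / (4 * real n)))"
proof -
  let ?q = "real d / (real n - 1)"
  let ?P = "random_subset G (1 - \<xi>)"
  let ?B = "\<lambda>w. {h. real (card (h \<inter> {e. w \<in> e})) > (1 - \<xi>) * real (card (G \<inter> {e. w \<in> e})) + s}"
  have GE: "G \<subseteq> complete_edges n" and deg: "\<And>w. w \<in> {1..n} \<Longrightarrow> degree G w = d"
    using G(1) by (auto simp: regular_graphs_def)
  have fin: "finite G" using GE by (rule finite_subset_complete_edges)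
  have cG: "card (G \<inter> {e. w \<in> e}) = d" if "w \<in> {1..n}" for w
    using deg[OF that] by (simp add: degree_def Collect_conj_eq)
  have B: "measure_pmf.prob ?P (?B w) \<le> exp (- (s\<^sup>2 / (4 * real n)))" if "w \<in> {1..n}" for w
    using fin n \<xi> s cG[OF that] by (intro prob_random_subset_upper_tail) auto
  let ?bad = "{h. real (card (backward_switchings n u v G h)) <
        (1 - ?q) * (\<xi> * real d - s)\<^sup>2 - real n - 2 * \<tau>}"
  have "measure_pmf.prob ?P ?bad \<le> measure_pmf.prob ?P (?B u \<union> ?B v)"
  proof (rule measure_pmf.finite_measure_mono_AE)
    show "AE h in ?P. h \<in> ?bad \<longrightarrow> h \<in> ?B u \<union> ?B v"
    proof (intro AE_pmfI impI, rule ccontr)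
      fix h assume h: "h \<in> set_pmf ?P" "h \<in> ?bad" "h \<notin> ?B u \<union> ?B v"
      have hG: "h \<subseteq> G" using h(1) set_pmf_random_subset[OF fin] by blast
      let ?N = "\<lambda>w. {x \<in> {1..n}. {w, x} \<in> G - h}"
      have N: "real (card (?N w)) \<ge> \<xi> * real d - s" if w: "w \<in> {1..n}" "h \<notin> ?B w" for w
      proof -
        have "card (?N w) = degree (G - h) w"
          using GE by (intro degree_eq_card_neighbours[symmetric]) auto
        also have "\<dots> = card (G \<inter> {e. w \<in> e} - h \<inter> {e. w \<in> e})"
          unfolding degree_def by (rule arg_cong[of _ _ card]) auto
        also have "\<dots> = card (G \<inter> {e. w \<in> e}) - card (h \<inter> {e. w \<in> e})"
          using hG fin by (intro card_Diff_subset) (auto intro: finite_subset)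
        finally have "card (?N w) = d - card (h \<inter> {e. w \<in> e})" using cG[OF w(1)] by simp
        moreover have "real (card (h \<inter> {e. w \<in> e})) \<le> (1 - \<xi>) * real d + s"
          using w cG[OF w(1)] by (simp add: not_less)
        ultimately show ?thesis by (simp add: algebra_simps)
      qed
      let ?A = "?N u" and ?C = "?N v"
      let ?O = "{(x, y). x \<in> ?A \<and> y \<in> ?C \<and> {x, y} \<in> G}"
      have sub: "?A \<subseteq> {1..n}" "?C \<subseteq> {1..n}" by auto
      have finAC: "finite ?A" "finite ?C" by auto
      have finO: "finite ?O" by (rule finite_subset[of _ "?A \<times> ?C"]) (use finAC in auto)
      have "?A \<times> ?C \<subseteq> backward_switchings n u v G h \<union> (\<lambda>x. (x, x)) ` {1..n} \<union> ?O"
        by (auto simp: backward_switchings_def)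
      then have "card (?A \<times> ?C) \<le> card (backward_switchings n u v G h \<union> (\<lambda>x. (x, x)) ` {1..n} \<union> ?O)"
        using finO by (intro card_mono) auto
      also have "\<dots> \<le> card (backward_switchings n u v G h) + card ((\<lambda>x. (x, x)) ` {1..n}) + card ?O"
        by (meson add_le_mono1 card_Un_le order_trans)
      also have "card ((\<lambda>x. (x, x)) ` {1..n}) \<le> n"
        using card_image_le[of "{1..n}" "\<lambda>x. (x, x)"] by simp
      finally have "card ?A * card ?C \<le> card (backward_switchings n u v G h) + n + card ?O"
        unfolding card_cartesian_product by simp
      then have "real (card ?A * card ?C) \<le> real (card (backward_switchings n u v G h) + n + card ?O)"
        by (rule of_nat_mono)
      moreover have "real (card ?O) \<le> ?q * (real (card ?A) * real (card ?C)) + 2 * \<tau>"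
        unfolding card_ordered_pairs_in_graph[OF GE finAC] of_nat_add
        by (rule upper_uniform_ordered_pairs[OF G(2) GE n(1) sub])
      ultimately have "real (card ?A) * real (card ?C) \<le>
          real (card (backward_switchings n u v G h)) + real n + (?q * (real (card ?A) * real (card ?C)) + 2 * \<tau>)"
        unfolding of_nat_mult of_nat_add by linarith
      then have "(1 - ?q) * (real (card ?A) * real (card ?C)) - real n - 2 * \<tau> \<le>
          real (card (backward_switchings n u v G h))"
        by (simp add: algebra_simps)
      moreover have "(1 - ?q) * (\<xi> * real d - s)\<^sup>2 \<le> (1 - ?q) * (real (card ?A) * real (card ?C))"
        unfolding power2_eq_square
      proof (intro mult_left_mono mult_mono)
        show "\<xi> * real d - s \<le> real (card ?A)" "\<xi> * real d - s \<le> real (card ?C)"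
          using N[OF uv(1)] N[OF uv(2)] h(3) by blast+
        show "0 \<le> 1 - ?q" using n by (simp add: divide_le_eq_1)
      qed (use s in auto)
      ultimately show False using h(2) by simp
    qed
  qed auto
  also have "\<dots> \<le> measure_pmf.prob ?P (?B u) + measure_pmf.prob ?P (?B v)"
    by (intro measure_Un_le) auto
  also have "\<dots> \<le> 2 * exp (- (s\<^sup>2 / (4 * real n)))"
    using B[OF uv(1)] B[OF uv(2)] by simp
  finally show ?thesis .
qed

text \<open>A forward switching is an ordered removed edge from the non-neighbours of
  \<open>u\<close> to those of \<open>v\<close>, two sets of size \<open>n - 1 - d\<close>. Upper
  uniformity bounds the edges of \<open>G\<close> there, and about a fraction \<xi> of them is
  removed. Both errors are doubled because the two sets may overlap.\<close>

lemma prob_many_forward_switchings_le: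
  fixes \<tau> \<xi> :: real
  assumes G: "G \<in> regular_graphs n d" "upper_uniform n d \<tau> G"
    and n: "n \<ge> 2" "d < n" and \<xi>: "0 < \<xi>" "\<xi> < 1" and \<tau>: "0 \<le> \<tau>"
    and uv: "u \<in> {1..n}" "v \<in> {1..n}"
  shows "measure_pmf.prob (random_subset (G - {{u, v}}) (1 - \<xi>))
      {h. real (card (forward_switchings n u v G h)) >
        \<xi> * (real d / (real n - 1) * (real n - 1 - real d)\<^sup>2 + 2 * \<tau>) + 2 * \<tau>} \<le>
    2 * exp (- (\<tau>\<^sup>2 / (4 * (real n)\<^sup>2)))"
proof -
  let ?q = "real d / (real n - 1)"
  let ?K = "G - {{u, v}}"
  let ?Q = "random_subset ?K \<xi>"
  have GE: "G \<subseteq> complete_edges n" and deg: "\<And>w. w \<in> {1..n} \<Longrightarrow> degree G w = d"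
    using G(1) by (auto simp: regular_graphs_def)
  have KE: "?K \<subseteq> complete_edges n" using GE by auto
  have fin: "finite ?K" using KE by (rule finite_subset_complete_edges)
  let ?N = "\<lambda>w. {x \<in> {1..n}. x \<noteq> w \<and> {w, x} \<notin> G}"
  let ?A = "?N u" and ?C = "?N v"
  have cN: "real (card (?N w)) = real n - 1 - real d" if w: "w \<in> {1..n}" for w
  proof -
    let ?M = "{x \<in> {1..n}. {w, x} \<in> G}"
    have "{w} \<notin> G" using GE by (auto simp: complete_edges_def)
    then have eq: "?N w = {1..n} - insert w ?M" "w \<notin> ?M" by auto
    have "card ?M = d" using deg[OF w] degree_eq_card_neighbours[OF GE, of w] by simp
    then have "card (insert w ?M) = Suc d" using eq(2) by (simp add: card_insert_if)
    then have "card (?N w) = n - Suc d" unfolding eq(1) using w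
      by (subst card_Diff_subset) auto
    then show ?thesis using n by (simp add: of_nat_diff)
  qed
  have sub: "?A \<subseteq> {1..n}" "?C \<subseteq> {1..n}" by auto
  have finAC: "finite ?A" "finite ?C" by auto
  let ?F1 = "edges_between ?A ?C" and ?F2 = "edges_between (?A \<inter> ?C) (?A \<inter> ?C)"
  let ?B = "\<lambda>F. {S. real (card (S \<inter> F)) > \<xi> * real (card (?K \<inter> F)) + \<tau>}"
  have B: "measure_pmf.prob ?Q (?B F) \<le> exp (- (\<tau>\<^sup>2 / (4 * (real n)\<^sup>2)))" for F
  proof (rule prob_random_subset_upper_tail)
    have "card (?K \<inter> F) \<le> card (complete_edges n)" using KE by (intro card_mono) auto
    then have "real (card (?K \<inter> F)) \<le> real n * (real n - 1) / 2"
      unfolding card_complete_edges[symmetric] by simp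
    also have "\<dots> \<le> (real n)\<^sup>2" by (simp add: power2_eq_square algebra_simps)
    finally show "real (card (?K \<inter> F)) \<le> (real n)\<^sup>2" .
  qed (use fin \<xi> n \<tau> in auto)
  let ?f0 = "\<xi> * (?q * (real n - 1 - real d)\<^sup>2 + 2 * \<tau>) + 2 * \<tau>"
  let ?fs = "\<lambda>S. {(x, y). x \<in> ?A \<and> y \<in> ?C \<and> {x, y} \<in> S}"
  have "measure_pmf.prob (random_subset ?K (1 - \<xi>)) {h. real (card (forward_switchings n u v G h)) > ?f0}
      \<le> measure_pmf.prob (random_subset ?K (1 - \<xi>)) ((\<lambda>h. ?K - h) -` {S. real (card (?fs S)) > ?f0})"
  proof (intro measure_pmf.finite_measure_mono subsetI)
    fix h assume h: "h \<in> {h. real (card (forward_switchings n u v G h)) > ?f0}"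
    have "forward_switchings n u v G h \<subseteq> ?fs (?K - h)" by (auto simp: forward_switchings_def)
    moreover have "finite (?fs (?K - h))"
      by (rule finite_subset[of _ "?A \<times> ?C"]) (use finAC in auto)
    ultimately have "card (forward_switchings n u v G h) \<le> card (?fs (?K - h))" by (rule card_mono[rotated])
    then show "h \<in> (\<lambda>h. ?K - h) -` {S. real (card (?fs S)) > ?f0}" using h by simp
  qed simp
  \<comment> \<open>The count increases with the removed edges, which form a random subset with
    probability \<xi>; the upper tail bound applies to them.\<close>
  also have "\<dots> = measure_pmf.prob ?Q {S. real (card (?fs S)) > ?f0}"
  proof -
    have eq: "map_pmf (\<lambda>h. ?K - h) (random_subset ?K (1 - \<xi>)) = ?Q"
      using random_subset_complement[OF fin, of "1 - \<xi>"] \<xi> by simp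
    show ?thesis unfolding eq[symmetric] measure_map_pmf by (rule refl)
  qed
  also have "\<dots> \<le> measure_pmf.prob ?Q (?B ?F1 \<union> ?B ?F2)"
  proof (rule measure_pmf.finite_measure_mono_AE)
    show "AE S in ?Q. S \<in> {S. real (card (?fs S)) > ?f0} \<longrightarrow> S \<in> ?B ?F1 \<union> ?B ?F2"
    proof (intro AE_pmfI impI, rule ccontr)
      fix S assume S: "S \<in> set_pmf ?Q" "S \<in> {S. real (card (?fs S)) > ?f0}" "S \<notin> ?B ?F1 \<union> ?B ?F2"
      have SE: "S \<subseteq> complete_edges n" using S(1) set_pmf_random_subset[OF fin] KE by blast
      have "real (card (?fs S)) = real (card (S \<inter> ?F1)) + real (card (S \<inter> ?F2))"
        unfolding card_ordered_pairs_in_graph[OF SE finAC] of_nat_add ..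
      also have "\<dots> \<le> (\<xi> * real (card (?K \<inter> ?F1)) + \<tau>) + (\<xi> * real (card (?K \<inter> ?F2)) + \<tau>)"
        using S(3) by (intro add_mono) auto
      also have "\<dots> = \<xi> * (real (card (?K \<inter> ?F1)) + real (card (?K \<inter> ?F2))) + 2 * \<tau>"
        by (simp add: algebra_simps)
      also have "\<dots> \<le> \<xi> * (real (card (G \<inter> ?F1)) + real (card (G \<inter> ?F2))) + 2 * \<tau>"
        using \<xi> finite_subset_complete_edges[OF GE]
        by (intro add_right_mono mult_left_mono add_mono of_nat_mono card_mono) auto
      also have "\<dots> \<le> \<xi> * (?q * (real (card ?A) * real (card ?C)) + 2 * \<tau>) + 2 * \<tau>"
        using \<xi> by (intro add_right_mono mult_left_mono upper_uniform_ordered_pairs[OF G(2) GE n(1) sub]) auto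
      also have "\<dots> = ?f0" unfolding cN[OF uv(1)] cN[OF uv(2)] by (simp add: power2_eq_square)
      finally show False using S(2) by simp
    qed
  qed auto
  also have "\<dots> \<le> measure_pmf.prob ?Q (?B ?F1) + measure_pmf.prob ?Q (?B ?F2)"
    by (intro measure_Un_le) auto
  also have "\<dots> \<le> 2 * exp (- (\<tau>\<^sup>2 / (4 * (real n)\<^sup>2)))"
    using B[of ?F1] B[of ?F2] by simp
  finally show ?thesis .
qed

section \<open>The lower coupling for given parameters\<close>

text \<open>Elements failing \<open>U\<close> are charged the trivial bound 1, all others
  \<epsilon>.\<close>

lemma sum_prob_le_card:
  fixes f :: "'a \<Rightarrow> real"
  assumes "finite R" "P \<subseteq> R" "\<And>G. G \<in> P \<Longrightarrow> f G \<le> 1" "0 \<le> \<epsilon>"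
    "\<And>G. G \<in> P \<Longrightarrow> U G \<Longrightarrow> f G \<le> \<epsilon>" "real (card {G \<in> R. \<not> U G}) \<le> \<beta> * real (card R)"
  shows "(\<Sum>G\<in>P. f G) \<le> (\<beta> + \<epsilon>) * real (card R)"
proof -
  have "(\<Sum>G\<in>P. f G) \<le> (\<Sum>G\<in>P. (if \<not> U G then 1 else 0) + \<epsilon>)"
  proof (rule sum_mono)
    fix G assume "G \<in> P"
    then show "f G \<le> (if \<not> U G then 1 else 0) + \<epsilon>"
      using assms(3)[of G] assms(4) assms(5)[of G] by (cases "U G") auto
  qed
  also have "\<dots> \<le> (\<Sum>G\<in>R. (if \<not> U G then 1 else 0) + \<epsilon>)"
    using assms(1,2,4) by (intro sum_mono2) auto
  also have "\<dots> = real (card {G \<in> R. \<not> U G}) + \<epsilon> * real (card R)"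
    using assms(1) by (simp add: sum.distrib sum.inter_filter[symmetric])
  finally show ?thesis using assms(6) by (simp add: algebra_simps)
qed

text \<open>The thinned graph is contained in the regular graph and contains the binomial graph up
  to the error of \<open>dominating_coupling\<close>; gluing along it gives the claim. The outer
  factor \<open>n\<^sup>2\<close> bounds the number of pairs, the inner one is the trivial bound on
  forward switchings.\<close>

lemma regular_graph_lower_coupling:
  fixes \<tau> s \<xi> t0 p :: real
  defines "q \<equiv> \<lambda>n d. real d / (real n - 1)"
  defines "b0 \<equiv> \<lambda>n d. (1 - q n d) * (\<xi> * real d - s)\<^sup>2 - real n - 2 * \<tau>"
  defines "f0 \<equiv> \<lambda>n d. \<xi> * (q n d * (real n - 1 - real d)\<^sup>2 + 2 * \<tau>) + 2 * \<tau>"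
  defines "\<beta> \<equiv> \<lambda>n. 4 ^ n * exp (- (\<tau>\<^sup>2 / (4 * (real n)\<^sup>2))) *
    (2 * (real (nat \<lfloor>real n * t0\<rfloor>) + 1) * real n ^ (3 * nat \<lfloor>real n * t0\<rfloor>))"
  assumes M: "even (d * n)" and n: "n \<ge> 2" "d < n" and t0: "0 \<le> t0"
    "real n * exp (- (t0\<^sup>2 / (4 * real n))) \<le> 1 / 2"
    and \<xi>: "0 < \<xi>" "\<xi> < 1" and p: "0 \<le> p" "p \<le> 1" and s: "0 \<le> s" "s \<le> \<xi> * real d" and \<tau>: "0 \<le> \<tau>"
    and b0: "1 \<le> b0 n d" and key: "p * \<xi> * f0 n d \<le> (1 - \<xi> - p) * b0 n d"
  shows "\<exists>\<Gamma>. map_pmf fst \<Gamma> = binomial_graph n p \<and> map_pmf snd \<Gamma> = regular_graph n d \<and>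
    measure_pmf.prob \<Gamma> {z. \<not> fst z \<subseteq> snd z} \<le> (real n)\<^sup>2 * ((\<beta> n + 2 * exp (- (s\<^sup>2 / (4 * real n)))) +
      (real n)\<^sup>2 * (\<beta> n + 2 * exp (- (\<tau>\<^sup>2 / (4 * (real n)\<^sup>2)))))"
proof -
  let ?R = "regular_graphs n d" and ?E = "complete_edges n"
  obtain M where M: "2 * M = d * n" using M by (metis evenE)
  have R: "?R \<noteq> {}" by (rule regular_graphs_nonempty[OF M n t0])
  have r: "real (card ?R) > 0" using R by (simp add: card_gt_0_iff)
  have \<beta>: "real (card {G \<in> ?R. \<not> upper_uniform n d \<tau> G}) \<le> \<beta> n * real (card ?R)"
    unfolding \<beta>_def by (rule card_regular_not_upper_uniform_le[OF M n(1) t0 \<tau>])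
  have q: "0 \<le> q n d" using n by (simp add: q_def)
  have f0: "0 \<le> f0 n d" using \<xi> \<tau> q by (auto simp: f0_def intro!: add_nonneg_nonneg mult_nonneg_nonneg)
  let ?err = "(\<beta> n + 2 * exp (- (s\<^sup>2 / (4 * real n)))) +
      (real n)\<^sup>2 * (\<beta> n + 2 * exp (- (\<tau>\<^sup>2 / (4 * (real n)\<^sup>2))))"
  have err: "0 \<le> ?err" by (simp add: \<beta>_def)
  \<comment> \<open>The joint law of the thinned graph and the regular graph; the second always
    contains the first.\<close>
  define J where "J = bind_pmf (pmf_of_set ?R) (\<lambda>G. map_pmf (\<lambda>h. (h, G)) (random_subset G (1 - \<xi>)))"
  define \<mu> where "\<mu> = bind_pmf (pmf_of_set ?R) (\<lambda>G. random_subset G (1 - \<xi>))"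
  have J1: "map_pmf fst J = \<mu>" by (simp add: J_def \<mu>_def map_bind_pmf map_pmf_comp)
  have J2: "map_pmf snd J = regular_graph n d"
    by (simp add: J_def regular_graph_def map_bind_pmf map_pmf_comp bind_return_pmf')
  have finG: "finite G" "G \<subseteq> ?E" if "G \<in> ?R" for G
    using that finite_subset_complete_edges by (auto simp: regular_graphs_def)
  have setR: "set_pmf (pmf_of_set ?R) = ?R" using R by (simp add: set_pmf_of_set)
  have J3: "fst z \<subseteq> snd z" if "z \<in> set_pmf J" for z
    using that set_pmf_random_subset[OF finG(1)] unfolding J_def set_bind_pmf setR by fastforce
  have "set_pmf \<mu> \<subseteq> Pow ?E"
    using set_pmf_random_subset[OF finG(1)] finG(2) unfolding \<mu>_def set_bind_pmf setR by fastforce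
  from dominating_coupling[OF finite_complete_edges p this]
  obtain \<Gamma>1 where \<Gamma>1: "map_pmf fst \<Gamma>1 = random_subset ?E p" "map_pmf snd \<Gamma>1 = \<mu>"
    "measure_pmf.prob \<Gamma>1 {z. \<not> fst z \<subseteq> snd z} \<le> (\<Sum>e\<in>?E. \<Sum>h\<in>Pow (?E - {e}).
        max 0 (p * (pmf \<mu> h + pmf \<mu> (insert e h)) - pmf \<mu> (insert e h)))" by blast
  have "(\<Sum>h\<in>Pow (?E - {e}). max 0 (p * (pmf \<mu> h + pmf \<mu> (insert e h)) - pmf \<mu> (insert e h))) \<le> ?err"
    if "e \<in> ?E" for e
  proof -
    from that have "card e = 2" "e \<subseteq> {1..n}" by (auto simp: complete_edges_def)
    then obtain u v where e: "e = {u, v}" and uv: "u \<in> {1..n}" "v \<in> {1..n}" "u \<noteq> v"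
      by (auto simp: card_2_iff)
    let ?SB = "\<Sum>G\<in>{G \<in> ?R. {u, v} \<notin> G}. measure_pmf.prob (random_subset G (1 - \<xi>))
        {h. real (card (backward_switchings n u v G h)) < b0 n d}"
    let ?SA = "\<Sum>G\<in>{G \<in> ?R. {u, v} \<in> G}. measure_pmf.prob (random_subset (G - {{u, v}}) (1 - \<xi>))
        {h. real (card (forward_switchings n u v G h)) > f0 n d}"
    have "(\<Sum>h\<in>Pow (?E - {e}). max 0 (p * (pmf \<mu> h + pmf \<mu> (insert e h)) - pmf \<mu> (insert e h))) \<le>
        (?SB + (real n)\<^sup>2 * ?SA) / real (card ?R)"
      unfolding e \<mu>_def by (rule deficiency_le[OF R M \<xi> p b0 f0 key uv])
    also have "?SB \<le> (\<beta> n + 2 * exp (- (s\<^sup>2 / (4 * real n)))) * real (card ?R)"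
      by (rule sum_prob_le_card[where U = "upper_uniform n d \<tau>"])
        (use \<beta> prob_few_backward_switchings_le[OF _ _ n \<xi> s uv(1,2)] in \<open>auto simp: b0_def q_def\<close>)
    also have "?SA \<le> (\<beta> n + 2 * exp (- (\<tau>\<^sup>2 / (4 * (real n)\<^sup>2)))) * real (card ?R)"
      by (rule sum_prob_le_card[where U = "upper_uniform n d \<tau>"])
        (use \<beta> prob_many_forward_switchings_le[OF _ _ n \<xi> \<tau> uv(1,2)] in \<open>auto simp: f0_def q_def\<close>)
    finally show ?thesis using r R
      by (simp add: divide_right_mono mult_left_mono add_mono distrib_right[symmetric] mult.assoc[symmetric])
  qed
  then have "measure_pmf.prob \<Gamma>1 {z. \<not> fst z \<subseteq> snd z} \<le> (\<Sum>e\<in>?E. ?err)"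
    using \<Gamma>1(3) by (meson order_trans sum_mono)
  also have "\<dots> = real (card ?E) * ?err" by simp
  also have "\<dots> \<le> (real n)\<^sup>2 * ?err"
  proof (rule mult_right_mono[OF _ err])
    show "real (card ?E) \<le> (real n)\<^sup>2"
      unfolding card_complete_edges by (simp add: power2_eq_square algebra_simps)
  qed
  finally have bound: "measure_pmf.prob \<Gamma>1 {z. \<not> fst z \<subseteq> snd z} \<le> (real n)\<^sup>2 * ?err" .
  have "map_pmf snd \<Gamma>1 = map_pmf fst J" using \<Gamma>1(2) J1 by simp
  then obtain T where T: "map_pmf (\<lambda>(a, b, c). (a, b)) T = \<Gamma>1" "map_pmf (\<lambda>(a, b, c). (b, c)) T = J"
    by (rule glue_couplings)
  define \<Gamma> where "\<Gamma> = map_pmf (\<lambda>(a, b, c). (a, c)) T"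
  have "map_pmf fst \<Gamma> = map_pmf fst \<Gamma>1"
    unfolding \<Gamma>_def T(1)[symmetric] by (simp add: map_pmf_comp case_prod_beta)
  then have 1: "map_pmf fst \<Gamma> = binomial_graph n p"
    using \<Gamma>1(1) by (simp add: binomial_graph_eq_random_subset)
  have "map_pmf snd \<Gamma> = map_pmf snd J"
    unfolding \<Gamma>_def T(2)[symmetric] by (simp add: map_pmf_comp case_prod_beta)
  then have 2: "map_pmf snd \<Gamma> = regular_graph n d" using J2 by simp
  have "measure_pmf.prob \<Gamma> {z. \<not> fst z \<subseteq> snd z} \<le> measure_pmf.prob \<Gamma>1 {z. \<not> fst z \<subseteq> snd z}"
    unfolding \<Gamma>_def T(1)[symmetric] measure_map_pmf
  proof (rule measure_pmf.finite_measure_mono_AE)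
    show "AE x in T. x \<in> (\<lambda>(a, b, c). (a, c)) -` {z. \<not> fst z \<subseteq> snd z} \<longrightarrow>
        x \<in> (\<lambda>(a, b, c). (a, b)) -` {z. \<not> fst z \<subseteq> snd z}"
    proof (rule AE_pmfI)
      fix x assume x: "x \<in> set_pmf T"
      obtain a b c where abc: "x = (a, b, c)" by (metis surj_pair)
      have "(b, c) \<in> set_pmf J" unfolding T(2)[symmetric] using x abc by force
      then have "b \<subseteq> c" using J3 by force
      then show "x \<in> (\<lambda>(a, b, c). (a, c)) -` {z. \<not> fst z \<subseteq> snd z} \<longrightarrow>
        x \<in> (\<lambda>(a, b, c). (a, b)) -` {z. \<not> fst z \<subseteq> snd z}" using abc by auto
    qed
  qed auto
  with bound 1 2 show ?thesis by (intro exI[of _ \<Gamma>]) auto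
qed

section \<open>The sandwich coupling\<close>

text \<open>In the application \<open>m\<close> is the number of vertices minus 1, and
  \<open>s\<close> and \<open>\<tau>\<close> are \<open>\<epsilon> ^ 9 * m\<close> and
  \<open>\<epsilon> ^ 9 * m\<^sup>2\<close>. Up to errors, \<open>b\<close> is
  \<open>(1 - q) * \<epsilon>\<^sup>2 * q\<^sup>2 * m\<^sup>2\<close> and \<open>f\<close> is
  \<open>\<epsilon> * q * (1 - q)\<^sup>2 * m\<^sup>2\<close>. For edge probability
  \<open>(1 - \<epsilon>) * q\<close> the main terms of the inequality would agree; the further loss
  of \<open>\<epsilon> * q\<close> leaves, in units of \<open>m\<^sup>2\<close>, a margin of
  \<open>\<epsilon> ^ 3 * q\<^sup>2 * (1 - q) \<ge> \<epsilon> ^ 6\<close>, which absorbs errors of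
  order \<open>\<epsilon> ^ 9\<close>.\<close>

lemma switching_ratio_bounds:
  fixes \<epsilon> q m n :: real
  assumes \<epsilon>: "0 < \<epsilon>" "\<epsilon> \<le> 1 / 2" and q: "\<epsilon> \<le> q" "\<epsilon> \<le> 1 - q" and n: "2 \<le> n" "n \<le> \<epsilon> ^ 9 * m\<^sup>2"
  defines "b \<equiv> (1 - q) * (\<epsilon> * (q * m) - \<epsilon> ^ 9 * m)\<^sup>2 - n - 2 * (\<epsilon> ^ 9 * m\<^sup>2)"
  defines "f \<equiv> \<epsilon> * (q * ((1 - q) * m)\<^sup>2 + 2 * (\<epsilon> ^ 9 * m\<^sup>2)) + 2 * (\<epsilon> ^ 9 * m\<^sup>2)"
  shows "1 \<le> b" "(1 - 2 * \<epsilon>) * q * \<epsilon> * f \<le> (1 - \<epsilon> - (1 - 2 * \<epsilon>) * q) * b"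
proof -
  have q0: "0 < q" "q < 1" using \<epsilon> q by auto
  have pos: "0 \<le> \<epsilon> ^ k" for k using \<epsilon> by simp
  have pw: "\<epsilon> ^ (k + j) \<le> (1 / 2) ^ k * \<epsilon> ^ j" for k j
    unfolding power_add using \<epsilon> by (intro mult_right_mono power_mono) auto
  \<comment> \<open>The four terms \<open>\<epsilon> ^ 9\<close> pay for the cross term of the
    square, for \<open>n\<close>, and twice for \<tau>.\<close>
  have b: "b \<ge> m\<^sup>2 * ((1 - q) * \<epsilon>\<^sup>2 * q\<^sup>2 - 4 * \<epsilon> ^ 9)"
  proof -
    have "(1 - q) * (2 * \<epsilon> ^ 10 * q) \<le> 1 * (2 * \<epsilon> ^ 10 * 1)"
      using q0 \<epsilon> by (intro mult_mono) auto
    also have "\<dots> \<le> \<epsilon> ^ 9" using pw[of 1 9] by simp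
    finally have "(1 - q) * (2 * \<epsilon> ^ 10 * q) \<le> \<epsilon> ^ 9" .
    moreover have "0 \<le> (1 - q) * \<epsilon> ^ 18" using q0 \<epsilon> by simp
    ultimately have "(1 - q) * \<epsilon>\<^sup>2 * q\<^sup>2 - 4 * \<epsilon> ^ 9 \<le>
        (1 - q) * \<epsilon>\<^sup>2 * q\<^sup>2 - (1 - q) * (2 * \<epsilon> ^ 10 * q) + (1 - q) * \<epsilon> ^ 18 - 3 * \<epsilon> ^ 9"
      by linarith
    then have "m\<^sup>2 * ((1 - q) * \<epsilon>\<^sup>2 * q\<^sup>2 - 4 * \<epsilon> ^ 9) \<le>
        m\<^sup>2 * ((1 - q) * \<epsilon>\<^sup>2 * q\<^sup>2 - (1 - q) * (2 * \<epsilon> ^ 10 * q) + (1 - q) * \<epsilon> ^ 18 - 3 * \<epsilon> ^ 9)"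
      by (rule mult_left_mono) simp
    also have "\<dots> = (1 - q) * (\<epsilon> * (q * m) - \<epsilon> ^ 9 * m)\<^sup>2 - \<epsilon> ^ 9 * m\<^sup>2 - 2 * (\<epsilon> ^ 9 * m\<^sup>2)"
      by algebra
    also have "\<dots> \<le> b" unfolding b_def using n by linarith
    finally show ?thesis .
  qed
  have f: "f \<le> m\<^sup>2 * (\<epsilon> * q * (1 - q)\<^sup>2 + 4 * \<epsilon> ^ 9)"
  proof -
    have "2 * \<epsilon> * (\<epsilon> ^ 9 * m\<^sup>2) \<le> 2 * (\<epsilon> ^ 9 * m\<^sup>2)"
      using \<epsilon> by (intro mult_right_mono) auto
    moreover have "f = m\<^sup>2 * (\<epsilon> * q * (1 - q)\<^sup>2 + 4 * \<epsilon> ^ 9) + 2 * \<epsilon> * (\<epsilon> ^ 9 * m\<^sup>2) - 2 * (\<epsilon> ^ 9 * m\<^sup>2)"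
      unfolding f_def by algebra
    ultimately show ?thesis by linarith
  qed
  have q3: "\<epsilon> ^ 3 \<le> q\<^sup>2 * (1 - q)"
  proof -
    have "\<epsilon>\<^sup>2 * \<epsilon> \<le> q\<^sup>2 * (1 - q)" using \<epsilon> q by (intro mult_mono power_mono) auto
    then show ?thesis by (simp add: power3_eq_cube power2_eq_square)
  qed
  show "1 \<le> b"
  proof -
    have "16 * \<epsilon> ^ 9 \<le> \<epsilon> ^ 5" using pw[of 4 5] by (simp add: power_divide)
    then have "2 * \<epsilon> ^ 9 \<le> \<epsilon> ^ 5 - 4 * \<epsilon> ^ 9" using pos[of 9] by linarith
    also have "\<epsilon> ^ 5 = \<epsilon>\<^sup>2 * \<epsilon> ^ 3" by (simp add: power_add[symmetric])
    also have "\<dots> \<le> \<epsilon>\<^sup>2 * (q\<^sup>2 * (1 - q))" using q3 by (intro mult_left_mono) auto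
    finally have "m\<^sup>2 * (2 * \<epsilon> ^ 9) \<le> m\<^sup>2 * ((1 - q) * \<epsilon>\<^sup>2 * q\<^sup>2 - 4 * \<epsilon> ^ 9)"
      by (intro mult_left_mono) (auto simp: mult_ac)
    moreover have "4 \<le> m\<^sup>2 * (2 * \<epsilon> ^ 9)" using n by (simp add: mult_ac)
    ultimately show ?thesis using b by linarith
  qed
  let ?p = "(1 - 2 * \<epsilon>) * q"
  have p: "0 \<le> ?p" "?p \<le> q" using \<epsilon> q0 by (auto simp: mult_left_le_one_le)
  have slack: "?p * \<epsilon> * (\<epsilon> * q * (1 - q)\<^sup>2 + 4 * \<epsilon> ^ 9) \<le>
      (1 - \<epsilon> - ?p) * ((1 - q) * \<epsilon>\<^sup>2 * q\<^sup>2 - 4 * \<epsilon> ^ 9)"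
  proof -
    have "?p * (4 * \<epsilon> ^ 10) + (1 - \<epsilon> - ?p) * (4 * \<epsilon> ^ 9) \<le> 1 * (4 * \<epsilon> ^ 10) + 1 * (4 * \<epsilon> ^ 9)"
    proof (intro add_mono mult_right_mono)
      show "?p \<le> 1" "1 - \<epsilon> - ?p \<le> 1" using p q0 \<epsilon> by linarith+
    qed (use \<epsilon> in auto)
    also have "\<dots> \<le> \<epsilon> ^ 6"
    proof -
      have "16 * \<epsilon> ^ 10 \<le> \<epsilon> ^ 6" "8 * \<epsilon> ^ 9 \<le> \<epsilon> ^ 6"
        using pw[of 4 6] pw[of 3 6] by (simp_all add: power_divide)
      then show ?thesis using pos[of 6] by linarith
    qed
    also have "\<epsilon> ^ 6 = \<epsilon> ^ 3 * \<epsilon> ^ 3" by (simp add: power_add[symmetric])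
    also have "\<dots> \<le> \<epsilon> ^ 3 * (q\<^sup>2 * (1 - q))" using q3 \<epsilon> by (intro mult_left_mono) auto
    finally have "?p * (4 * \<epsilon> ^ 10) + (1 - \<epsilon> - ?p) * (4 * \<epsilon> ^ 9) \<le> \<epsilon> ^ 3 * (q\<^sup>2 * (1 - q))" .
    moreover have "(1 - \<epsilon> - ?p) * ((1 - q) * \<epsilon>\<^sup>2 * q\<^sup>2 - 4 * \<epsilon> ^ 9) -
        ?p * \<epsilon> * (\<epsilon> * q * (1 - q)\<^sup>2 + 4 * \<epsilon> ^ 9) =
        \<epsilon> ^ 3 * (q\<^sup>2 * (1 - q)) - (?p * (4 * \<epsilon> ^ 10) + (1 - \<epsilon> - ?p) * (4 * \<epsilon> ^ 9))"
      by algebra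
    ultimately show ?thesis by linarith
  qed
  have "?p * \<epsilon> * f \<le> ?p * \<epsilon> * (m\<^sup>2 * (\<epsilon> * q * (1 - q)\<^sup>2 + 4 * \<epsilon> ^ 9))"
    using p \<epsilon> f by (intro mult_left_mono) auto
  also have "\<dots> = m\<^sup>2 * (?p * \<epsilon> * (\<epsilon> * q * (1 - q)\<^sup>2 + 4 * \<epsilon> ^ 9))" by simp
  also have "\<dots> \<le> m\<^sup>2 * ((1 - \<epsilon> - ?p) * ((1 - q) * \<epsilon>\<^sup>2 * q\<^sup>2 - 4 * \<epsilon> ^ 9))"
    using slack by (intro mult_left_mono) auto
  also have "\<dots> = (1 - \<epsilon> - ?p) * (m\<^sup>2 * ((1 - q) * \<epsilon>\<^sup>2 * q\<^sup>2 - 4 * \<epsilon> ^ 9))" by simp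
  also have "\<dots> \<le> (1 - \<epsilon> - ?p) * b"
  proof (rule mult_left_mono[OF b])
    show "0 \<le> 1 - \<epsilon> - ?p" using p q by linarith
  qed
  finally show "?p * \<epsilon> * f \<le> (1 - \<epsilon> - ?p) * b" .
qed

text \<open>\<open>T\<close> bounds the number of edge moves that make a typical graph regular, so \<open>\<beta>\<close> bounds the
  proportion of regular graphs that are not upper uniform.\<close>

definition coupling_error :: "nat \<Rightarrow> real" where
  "coupling_error n = (let
     \<epsilon> = 1 / ln (real n); s = \<epsilon> ^ 9 * (real n - 1); \<tau> = \<epsilon> ^ 9 * (real n - 1)\<^sup>2;
     T = nat \<lfloor>real n * real n powr (3 / 4)\<rfloor>;
     \<beta> = 4 ^ n * exp (- (\<tau>\<^sup>2 / (4 * (real n)\<^sup>2))) * (2 * (real T + 1) * real n ^ (3 * T))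
   in (real n)\<^sup>2 * ((\<beta> + 2 * exp (- (s\<^sup>2 / (4 * real n)))) +
      (real n)\<^sup>2 * (\<beta> + 2 * exp (- (\<tau>\<^sup>2 / (4 * (real n)\<^sup>2))))))"

text \<open>\<open>\<tau>\<^sup>2 / (4 * n\<^sup>2)\<close> is of order
  \<open>n\<^sup>2 / (ln n) ^ 18\<close>, which beats both \<open>n * ln 4\<close> from the union
  bound and \<open>n powr (7 / 4) * ln n\<close> from the rarity of regular graphs;
  \<open>s\<^sup>2 / (4 * n)\<close> is of order \<open>n / (ln n) ^ 18\<close>.\<close>

lemma coupling_error_tendsto_0: "coupling_error \<longlonglongrightarrow> 0"
proof -
  define \<epsilon> where "\<epsilon> n = 1 / ln (real n)" for n :: nat
  define s where "s n = \<epsilon> n ^ 9 * (real n - 1)" for n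
  define \<tau> where "\<tau> n = \<epsilon> n ^ 9 * (real n - 1)\<^sup>2" for n
  define T where "T n = nat \<lfloor>real n * real n powr (3 / 4)\<rfloor>" for n :: nat
  define \<beta> where "\<beta> n = 4 ^ n * exp (- ((\<tau> n)\<^sup>2 / (4 * (real n)\<^sup>2))) *
    (2 * (real (T n) + 1) * real n ^ (3 * T n))" for n
  \<comment> \<open>An upper bound for \<beta> without the floor, in a form that
    \<open>real_asymp\<close> can treat.\<close>
  define \<gamma> where "\<gamma> n = exp (real n * ln 4 - (\<tau> n)\<^sup>2 / (4 * (real n)\<^sup>2) +
    3 * (real n * real n powr (3 / 4)) * ln (real n)) * (2 * (real n * real n powr (3 / 4) + 1))" for n
  have eq: "coupling_error n = ((real n)\<^sup>2 + (real n) ^ 4) * \<beta> n +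
      (2 * (real n)\<^sup>2 * exp (- ((s n)\<^sup>2 / (4 * real n))) +
       2 * (real n) ^ 4 * exp (- ((\<tau> n)\<^sup>2 / (4 * (real n)\<^sup>2))))" for n
    unfolding coupling_error_def Let_def \<beta>_def T_def \<tau>_def s_def \<epsilon>_def by algebra
  have \<beta>0: "0 \<le> \<beta> n" for n by (simp add: \<beta>_def)
  have \<beta>\<gamma>: "\<beta> n \<le> \<gamma> n" if "n \<ge> 1" for n
  proof -
    have T: "real (T n) \<le> real n * real n powr (3 / 4)" unfolding T_def by simp
    have "real n ^ (3 * T n) = exp (ln (real n)) ^ (3 * T n)" using that by simp
    also have "\<dots> = exp (real (3 * T n) * ln (real n))" by (rule exp_of_nat_mult[symmetric])
    also have "\<dots> \<le> exp (3 * (real n * real n powr (3 / 4)) * ln (real n))"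
      using T that by (intro exp_le_cancel_iff[THEN iffD2] mult_right_mono) auto
    finally have P: "real n ^ (3 * T n) \<le> exp (3 * (real n * real n powr (3 / 4)) * ln (real n))" .
    have "\<beta> n \<le> 4 ^ n * exp (- ((\<tau> n)\<^sup>2 / (4 * (real n)\<^sup>2))) *
      (2 * (real n * real n powr (3 / 4) + 1) * exp (3 * (real n * real n powr (3 / 4)) * ln (real n)))"
      unfolding \<beta>_def using T P by (intro mult_left_mono mult_mono) auto
    also have "(4 :: real) ^ n = exp (real n * ln 4)"
      by (simp add: exp_of_nat_mult)
    finally show ?thesis by (simp add: \<gamma>_def exp_add exp_diff exp_minus field_simps)
  qed
  have g: "(\<lambda>n. ((real n)\<^sup>2 + (real n) ^ 4) * \<gamma> n) \<longlonglongrightarrow> 0"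
    unfolding \<gamma>_def \<tau>_def \<epsilon>_def by real_asymp
  have "(\<lambda>n. ((real n)\<^sup>2 + (real n) ^ 4) * \<beta> n) \<longlonglongrightarrow> 0"
  proof (rule tendsto_sandwich[OF _ _ tendsto_const g])
    show "\<forall>\<^sub>F n in sequentially. 0 \<le> ((real n)\<^sup>2 + (real n) ^ 4) * \<beta> n"
      using \<beta>0 by simp
    show "\<forall>\<^sub>F n in sequentially. ((real n)\<^sup>2 + (real n) ^ 4) * \<beta> n \<le> ((real n)\<^sup>2 + (real n) ^ 4) * \<gamma> n"
      using eventually_ge_at_top[of 1] by eventually_elim (use \<beta>\<gamma> in \<open>auto intro!: mult_left_mono\<close>)
  qed
  moreover have "(\<lambda>n. 2 * (real n)\<^sup>2 * exp (- ((s n)\<^sup>2 / (4 * real n))) +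
       2 * (real n) ^ 4 * exp (- ((\<tau> n)\<^sup>2 / (4 * (real n)\<^sup>2)))) \<longlonglongrightarrow> 0"
    unfolding s_def \<tau>_def \<epsilon>_def by real_asymp
  ultimately show ?thesis unfolding eq by (rule tendsto_add_zero)
qed

section \<open>Complements and the sandwich for a single \<open>n\<close>\<close>

lemma degree_complement:
  assumes "G \<subseteq> complete_edges n" "v \<in> {1..n}"
  shows "degree (complete_edges n - G) v = n - 1 - degree G v"
proof -
  have "{e \<in> complete_edges n - G. v \<in> e} = {e \<in> complete_edges n. v \<in> e} - {e \<in> G. v \<in> e}" by auto
  moreover have "card ({e \<in> complete_edges n. v \<in> e} - {e \<in> G. v \<in> e}) =
      card {e \<in> complete_edges n. v \<in> e} - card {e \<in> G. v \<in> e}"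
    using assms(1) finite_subset_complete_edges[OF assms(1)] by (intro card_Diff_subset) auto
  ultimately show ?thesis using degree_complete_edges[OF assms(2)] by (simp add: degree_def)
qed

lemma complement_regular_graphs:
  assumes "G \<in> regular_graphs n d"
  shows "complete_edges n - G \<in> regular_graphs n (n - 1 - d)"
  using assms by (auto simp: regular_graphs_def degree_complement)

lemma regular_graph_complement:
  assumes "d \<le> n - 1" "regular_graphs n d \<noteq> {}"
  shows "map_pmf (\<lambda>G. complete_edges n - G) (regular_graph n (n - 1 - d)) = regular_graph n d"
proof -
  let ?c = "\<lambda>G. complete_edges n - G"
  have dd: "n - 1 - (n - 1 - d) = d" using assms(1) by simp
  have sub: "G \<subseteq> complete_edges n" if "G \<in> regular_graphs n k" for G k
    using that by (simp add: regular_graphs_def)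
  have "bij_betw ?c (regular_graphs n (n - 1 - d)) (regular_graphs n d)"
  proof (rule bij_betw_byWitness[where f' = ?c])
    show "?c ` regular_graphs n (n - 1 - d) \<subseteq> regular_graphs n d"
      using complement_regular_graphs[of _ n "n - 1 - d"] unfolding dd by blast
    show "?c ` regular_graphs n d \<subseteq> regular_graphs n (n - 1 - d)"
      using complement_regular_graphs by blast
  qed (use sub in \<open>auto simp: double_diff\<close>)
  moreover have "regular_graphs n (n - 1 - d) \<noteq> {}"
    using assms(2) complement_regular_graphs by blast
  ultimately show ?thesis
    unfolding regular_graph_def by (intro map_pmf_of_set_bij_betw) auto
qed

text \<open>The demands of the lower coupling on a single pair \<open>n\<close>, \<open>d\<close>
  when \<xi> is \<open>1 / ln n\<close> and \<open>t0\<close> is \<open>n powr (3 / 4)\<close>. The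
  density conditions are symmetric, so that \<open>n - 1 - d\<close> qualifies together with
  \<open>d\<close>.\<close>

definition admissible :: "nat \<Rightarrow> nat \<Rightarrow> bool" where
  "admissible n d \<longleftrightarrow> n \<ge> 2 \<and> d < n \<and> even (d * n) \<and> 2 \<le> ln (real n) \<and>
     1 / ln (real n) \<le> real d / (real n - 1) \<and> 1 / ln (real n) \<le> 1 - real d / (real n - 1) \<and>
     real n \<le> (1 / ln (real n)) ^ 9 * (real n - 1)\<^sup>2 \<and>
     real n * exp (- ((real n powr (3 / 4))\<^sup>2 / (4 * real n))) \<le> 1 / 2"

lemma admissible_complement:
  assumes "admissible n d"
  shows "admissible n (n - 1 - d)" "real (n - 1 - d) / (real n - 1) = 1 - real d / (real n - 1)"
proof -
  have nd: "n \<ge> 2" "d < n" using assms by (auto simp: admissible_def)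
  then show eq: "real (n - 1 - d) / (real n - 1) = 1 - real d / (real n - 1)"
    by (simp add: of_nat_diff divide_simps)
  \<comment> \<open>The parity condition passes from \<open>d\<close> to \<open>n - 1 - d\<close>
    because the two products add up to this even number.\<close>
  have "even ((n - 1) * n)" by (cases n) auto
  moreover have "(n - 1 - d) * n + d * n = (n - 1) * n"
    using nd by (simp flip: distrib_right)
  ultimately have "even ((n - 1 - d) * n)"
    using assms by (metis admissible_def even_add)
  then show "admissible n (n - 1 - d)"
    using assms nd eq unfolding admissible_def by (simp only: eq) auto
qed

text \<open>The general coupling at thinning rate \<open>1 / ln n\<close>; the loss of twice this
  rate in \<open>p\<close> provides the margin of \<open>switching_ratio_bounds\<close>.\<close>

lemma admissible_lower_coupling:
  assumes "admissible n d"
  defines "p \<equiv> (1 - 2 * (1 / ln (real n))) * (real d / (real n - 1))"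
  shows "0 \<le> p" "p \<le> 1"
    "\<exists>\<Gamma>. map_pmf fst \<Gamma> = binomial_graph n p \<and> map_pmf snd \<Gamma> = regular_graph n d \<and>
      measure_pmf.prob \<Gamma> {z. \<not> fst z \<subseteq> snd z} \<le> coupling_error n"
proof -
  define \<epsilon> where "\<epsilon> = 1 / ln (real n)"
  define q where "q = real d / (real n - 1)"
  define m where "m = real n - 1"
  have A: "n \<ge> 2" "d < n" "even (d * n)" "2 \<le> ln (real n)" "\<epsilon> \<le> q" "\<epsilon> \<le> 1 - q"
    "real n \<le> \<epsilon> ^ 9 * m\<^sup>2" "real n * exp (- ((real n powr (3 / 4))\<^sup>2 / (4 * real n))) \<le> 1 / 2"
    using assms unfolding admissible_def \<epsilon>_def q_def m_def by auto
  have \<epsilon>: "0 < \<epsilon>" "\<epsilon> \<le> 1 / 2" using A(4) by (auto simp: \<epsilon>_def divide_simps)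
  have m: "m > 0" using A(1) by (simp add: m_def)
  have d: "real d = q * m" using m by (simp add: q_def m_def)
  have a: "real n - 1 - real d = (1 - q) * m" unfolding d m_def[symmetric] by (simp add: algebra_simps)
  have p: "p = (1 - 2 * \<epsilon>) * q" by (simp add: p_def \<epsilon>_def q_def)
  have q: "0 \<le> q" "q \<le> 1" using A(5,6) \<epsilon> by auto
  show p01: "0 \<le> p" "p \<le> 1" unfolding p using \<epsilon> q by (auto intro: mult_le_one)
  have s: "0 \<le> \<epsilon> ^ 9 * m" "\<epsilon> ^ 9 * m \<le> \<epsilon> * real d"
  proof -
    show "0 \<le> \<epsilon> ^ 9 * m" using \<epsilon> m by simp
    have "\<epsilon> ^ 8 \<le> \<epsilon> ^ 1" using \<epsilon> by (intro power_decreasing) auto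
    then have "\<epsilon> * \<epsilon> ^ 8 * m \<le> \<epsilon> * q * m" using A(5) \<epsilon> m by (intro mult_right_mono mult_left_mono) auto
    then show "\<epsilon> ^ 9 * m \<le> \<epsilon> * real d" unfolding d by (simp add: mult.assoc power_Suc[symmetric])
  qed
  have n2: "2 \<le> real n" using A(1) by simp
  note bounds = switching_ratio_bounds[OF \<epsilon> A(5,6) n2 A(7), folded p d a]
  have "\<exists>\<Gamma>. map_pmf fst \<Gamma> = binomial_graph n p \<and> map_pmf snd \<Gamma> = regular_graph n d \<and>
    measure_pmf.prob \<Gamma> {z. \<not> fst z \<subseteq> snd z} \<le> (real n)\<^sup>2 * ((4 ^ n * exp (- ((\<epsilon> ^ 9 * m\<^sup>2)\<^sup>2 / (4 * (real n)\<^sup>2))) *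
    (2 * (real (nat \<lfloor>real n * real n powr (3 / 4)\<rfloor>) + 1) * real n ^ (3 * nat \<lfloor>real n * real n powr (3 / 4)\<rfloor>)) +
      2 * exp (- ((\<epsilon> ^ 9 * m)\<^sup>2 / (4 * real n)))) +
      (real n)\<^sup>2 * (4 ^ n * exp (- ((\<epsilon> ^ 9 * m\<^sup>2)\<^sup>2 / (4 * (real n)\<^sup>2))) *
    (2 * (real (nat \<lfloor>real n * real n powr (3 / 4)\<rfloor>) + 1) * real n ^ (3 * nat \<lfloor>real n * real n powr (3 / 4)\<rfloor>)) +
      2 * exp (- ((\<epsilon> ^ 9 * m\<^sup>2)\<^sup>2 / (4 * (real n)\<^sup>2)))))"
    by (rule regular_graph_lower_coupling[where \<xi> = \<epsilon>])
      (use A(1-3,8) \<epsilon> p01 s bounds in \<open>simp_all flip: q_def\<close>)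
  then show "\<exists>\<Gamma>. map_pmf fst \<Gamma> = binomial_graph n p \<and> map_pmf snd \<Gamma> = regular_graph n d \<and>
      measure_pmf.prob \<Gamma> {z. \<not> fst z \<subseteq> snd z} \<le> coupling_error n"
    unfolding coupling_error_def Let_def \<epsilon>_def m_def .
qed

text \<open>The lower coupling for \<open>d\<close> and the complemented lower coupling for
  \<open>n - 1 - d\<close> share the regular graph and are glued along it. Each inclusion fails with
  probability at most \<open>coupling_error n\<close>.\<close>

lemma admissible_sandwich:
  assumes "admissible n d"
  defines "\<epsilon> \<equiv> 1 / ln (real n)" and "q \<equiv> real d / (real n - 1)"
  shows "\<exists>\<Gamma>. coupling3 \<Gamma> (binomial_graph n ((1 - 2 * \<epsilon>) * q)) (regular_graph n d)
      (binomial_graph n (1 - (1 - 2 * \<epsilon>) * (1 - q))) \<and>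
    measure_pmf.prob \<Gamma> {(GL, G, GU). GL \<subseteq> G \<and> G \<subseteq> GU} \<ge> 1 - 2 * coupling_error n"
proof -
  let ?E = "complete_edges n" and ?d' = "n - 1 - d"
  let ?p = "(1 - 2 * \<epsilon>) * q" and ?p' = "(1 - 2 * \<epsilon>) * (1 - q)"
  let ?bad = "{z :: graph \<times> graph. \<not> fst z \<subseteq> snd z}"
  have n: "n \<ge> 2" "d < n" using assms(1) by (auto simp: admissible_def)
  obtain P where P: "map_pmf fst P = binomial_graph n ?p" "map_pmf snd P = regular_graph n d"
    "measure_pmf.prob P ?bad \<le> coupling_error n"
    using admissible_lower_coupling(3)[OF assms(1)] unfolding \<epsilon>_def q_def by blast
  note compl = admissible_complement[OF assms(1)]
  have p': "0 \<le> ?p'" "?p' \<le> 1"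
    using admissible_lower_coupling(1,2)[OF compl(1)] unfolding compl(2) \<epsilon>_def q_def by auto
  obtain Q' where Q': "map_pmf fst Q' = binomial_graph n ?p'" "map_pmf snd Q' = regular_graph n ?d'"
    "measure_pmf.prob Q' ?bad \<le> coupling_error n"
    using admissible_lower_coupling(3)[OF compl(1)] unfolding compl(2) \<epsilon>_def q_def by blast
  have R: "regular_graphs n d \<noteq> {}"
  proof -
    obtain M where "2 * M = d * n" using assms(1) unfolding admissible_def by (metis evenE)
    then show ?thesis using assms(1) n
      by (intro regular_graphs_nonempty[of M d n "real n powr (3 / 4)"]) (auto simp: admissible_def)
  qed
  \<comment> \<open>Complementing reverses inclusion, so the coordinates are swapped as
    well.\<close>
  define Q where "Q = map_pmf (\<lambda>z. (?E - snd z, ?E - fst z)) Q'"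
  have "map_pmf fst Q = map_pmf (\<lambda>G. ?E - G) (map_pmf snd Q')" by (simp add: Q_def map_pmf_comp)
  then have Q1: "map_pmf fst Q = regular_graph n d"
    using regular_graph_complement[OF _ R] n Q'(2) by simp
  have "map_pmf snd Q = map_pmf (\<lambda>G. ?E - G) (map_pmf fst Q')" by (simp add: Q_def map_pmf_comp)
  then have Q2: "map_pmf snd Q = binomial_graph n (1 - ?p')"
    using random_subset_complement[OF finite_complete_edges p'] Q'(1)
    by (simp add: binomial_graph_eq_random_subset)
  have "measure_pmf.prob Q ?bad \<le> measure_pmf.prob Q' ?bad"
    unfolding Q_def measure_map_pmf by (intro measure_pmf.finite_measure_mono) auto
  with Q'(3) have Q3: "measure_pmf.prob Q ?bad \<le> coupling_error n" by simp
  have "map_pmf snd P = map_pmf fst Q" using P Q1 by simp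
  then obtain \<Gamma> where \<Gamma>: "map_pmf (\<lambda>(a, b, c). (a, b)) \<Gamma> = P" "map_pmf (\<lambda>(a, b, c). (b, c)) \<Gamma> = Q"
    by (rule glue_couplings)
  have "map_pmf (\<lambda>(x, y, z). x) \<Gamma> = map_pmf fst P" "map_pmf (\<lambda>(x, y, z). y) \<Gamma> = map_pmf snd P"
    unfolding \<Gamma>(1)[symmetric] by (simp_all add: map_pmf_comp case_prod_unfold)
  moreover have "map_pmf (\<lambda>(x, y, z). z) \<Gamma> = map_pmf snd Q"
    unfolding \<Gamma>(2)[symmetric] by (simp add: map_pmf_comp case_prod_unfold)
  ultimately have c3: "coupling3 \<Gamma> (binomial_graph n ?p) (regular_graph n d) (binomial_graph n (1 - ?p'))"
    using P Q2 by (simp add: coupling3_def)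
  let ?S = "{(GL, G, GU). GL \<subseteq> G \<and> G \<subseteq> GU} :: (graph \<times> graph \<times> graph) set"
  have "1 - measure_pmf.prob \<Gamma> ?S = measure_pmf.prob \<Gamma> (- ?S)"
    using measure_pmf.prob_compl[of ?S \<Gamma>] by (simp add: Compl_eq_Diff_UNIV)
  also have "\<dots> \<le> measure_pmf.prob \<Gamma> ((\<lambda>(a, b, c). (a, b)) -` ?bad \<union> (\<lambda>(a, b, c). (b, c)) -` ?bad)"
    by (intro measure_pmf.finite_measure_mono) auto
  also have "\<dots> \<le> measure_pmf.prob \<Gamma> ((\<lambda>(a, b, c). (a, b)) -` ?bad) +
      measure_pmf.prob \<Gamma> ((\<lambda>(a, b, c). (b, c)) -` ?bad)"
    by (intro measure_Un_le) auto
  also have "\<dots> = measure_pmf.prob P ?bad + measure_pmf.prob Q ?bad"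
    unfolding \<Gamma>[symmetric] measure_map_pmf ..
  also have "\<dots> \<le> 2 * coupling_error n" using P(3) Q3 by simp
  finally have "measure_pmf.prob \<Gamma> ?S \<ge> 1 - 2 * coupling_error n" by simp
  with c3 show ?thesis by blast
qed

text \<open>The independent coupling fills in for those \<open>n\<close> that are not
  admissible.\<close>

lemma coupling3_product: "coupling3 (pair_pmf A (pair_pmf B C)) A B C"
proof -
  have "map_pmf (\<lambda>(x, y, z). y) (pair_pmf A (pair_pmf B C)) = map_pmf fst (map_pmf snd (pair_pmf A (pair_pmf B C)))"
    "map_pmf (\<lambda>(x, y, z). z) (pair_pmf A (pair_pmf B C)) = map_pmf snd (map_pmf snd (pair_pmf A (pair_pmf B C)))"
    "map_pmf (\<lambda>(x, y, z). x) (pair_pmf A (pair_pmf B C)) = map_pmf fst (pair_pmf A (pair_pmf B C))"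
    unfolding map_pmf_comp by (simp_all only: case_prod_unfold)
  then show ?thesis unfolding coupling3_def by (simp only: map_fst_pair_pmf map_snd_pair_pmf)
qed

section \<open>Passage to the limit\<close>

text \<open>Eventually \<open>d\<close> and \<open>n - d\<close> exceed
  \<open>n / sqrt (ln n)\<close>, which is far more than the required
  \<open>(n - 1) / ln n\<close>.\<close>

lemma eventually_admissible:
  assumes "\<And>n. even (d n * n)"
    and "much_greater (\<lambda>n. min (real (d n)) (real n - real (d n))) (\<lambda>n. real n / sqrt (ln (real n)))"
  shows "\<forall>\<^sub>F n in sequentially. admissible n (d n) \<and> real n / sqrt (ln (real n)) \<le> real (d n)"
proof -
  let ?a = "\<lambda>n. min (real (d n)) (real n - real (d n))" and ?b = "\<lambda>n. real n / sqrt (ln (real n))"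
  have pos: "\<forall>\<^sub>F n in sequentially. 0 < ?a n \<and> 0 < ?b n" and lim: "(\<lambda>n. ?b n / ?a n) \<longlonglongrightarrow> 0"
    using assms(2) by (auto simp: much_greater_def)
  have lt: "\<forall>\<^sub>F n in sequentially. ?b n / ?a n < 1"
    using lim by (rule order_tendstoD) simp
  have 1: "\<forall>\<^sub>F n in sequentially. 2 \<le> ln (real n)" by real_asymp
  have 2: "\<forall>\<^sub>F n in sequentially. real n \<le> (1 / ln (real n)) ^ 9 * (real n - 1)\<^sup>2" by real_asymp
  have 3: "\<forall>\<^sub>F n in sequentially. real n * exp (- ((real n powr (3 / 4))\<^sup>2 / (4 * real n))) \<le> 1 / 2"
    by real_asymp
  \<comment> \<open>The \<open>- 1\<close> covers the difference between \<open>n - d\<close> and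
    \<open>n - 1 - d\<close>.\<close>
  have 4: "\<forall>\<^sub>F n in sequentially. (real n - 1) / ln (real n) \<le> real n / sqrt (ln (real n)) - 1"
    by real_asymp
  have 5: "\<forall>\<^sub>F n in sequentially. (real n - 1) / ln (real n) \<le> real n / sqrt (ln (real n))"
    by real_asymp
  show ?thesis
    using pos lt 1 2 3 4 5 eventually_ge_at_top[of 2]
  proof eventually_elim
    case (elim n)
    then have "?b n < ?a n" using divide_less_eq_1_pos[of "?a n" "?b n"] by blast
    then have b: "?b n < real (d n)" "?b n < real n - real (d n)" by auto
    have m: "real n - 1 > 0" using elim by simp
    have "(real n - 1) / ln (real n) \<le> real (d n)" "(real n - 1) / ln (real n) \<le> real n - 1 - real (d n)"
      using b elim by linarith+
    then have "1 / ln (real n) \<le> real (d n) / (real n - 1)"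
      "1 / ln (real n) \<le> (real n - 1 - real (d n)) / (real n - 1)"
      using m by (simp_all add: le_divide_eq)
    moreover have "(real n - 1 - real (d n)) / (real n - 1) = 1 - real (d n) / (real n - 1)"
      using m by (simp add: diff_divide_distrib)
    moreover have "d n < n" using elim b by linarith
    ultimately show ?case using elim assms(1)[of n] b unfolding admissible_def by simp
  qed
qed

theorem theorem2p2:
  fixes d :: "nat \<Rightarrow> nat"
  assumes "\<And>n. even (d n * n)"
    and "much_greater (\<lambda>n. min (real (d n)) (real n - real (d n)))
           (\<lambda>n. real n / sqrt (ln (real n)))"
  shows "\<exists>(p1 :: nat \<Rightarrow> real) (p2 :: nat \<Rightarrow> real) (\<epsilon>1 :: nat \<Rightarrow> real) (\<epsilon>2 :: nat \<Rightarrow> real)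
           (\<Gamma> :: nat \<Rightarrow> (graph \<times> graph \<times> graph) pmf).
           (\<forall>n. p1 n \<in> {0..1} \<and> p2 n \<in> {0..1}) \<and>
           (\<forall>n. p1 n = (1 - \<epsilon>1 n) * (real (d n) / real n)) \<and> \<epsilon>1 \<longlonglongrightarrow> 0 \<and>
           (\<forall>n. p2 n = (1 + \<epsilon>2 n) * (real (d n) / real n)) \<and> \<epsilon>2 \<longlonglongrightarrow> 0 \<and>
           (\<forall>n. coupling3 (\<Gamma> n) (binomial_graph n (p1 n)) (regular_graph n (d n))
                  (binomial_graph n (p2 n))) \<and>
           (\<lambda>n. measure_pmf.prob (\<Gamma> n) {(GL, G, GU). GL \<subseteq> G \<and> G \<subseteq> GU}) \<longlonglongrightarrow> 1"
proof -
  define \<epsilon> where "\<epsilon> n = 1 / ln (real n)" for n :: nat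
  define q where "q n = real (d n) / (real n - 1)" for n
  let ?ok = "\<lambda>n. admissible n (d n)"
  let ?S = "{(GL, G, GU). GL \<subseteq> G \<and> G \<subseteq> GU} :: (graph \<times> graph \<times> graph) set"
  \<comment> \<open>For \<open>n\<close> that are not admissible both probabilities are 0, and the
    relative errors 1 and -1 keep the required identities true for every \<open>n\<close>.\<close>
  define p1 where "p1 n = (if ?ok n then (1 - 2 * \<epsilon> n) * q n else 0)" for n
  define p2 where "p2 n = (if ?ok n then 1 - (1 - 2 * \<epsilon> n) * (1 - q n) else 0)" for n
  define \<epsilon>1 where "\<epsilon>1 n = (if ?ok n then 1 - (1 - 2 * \<epsilon> n) * (real n / (real n - 1)) else 1)" for n
  define \<epsilon>2 where "\<epsilon>2 n = (if ?ok n then p2 n * (real n / real (d n)) - 1 else -1)" for n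
  have ok: "n \<ge> 2" "0 < d n" "d n < n" if "?ok n" for n
  proof -
    show "n \<ge> 2" "d n < n" using that by (auto simp: admissible_def)
    have "0 < 1 / ln (real n)" "1 / ln (real n) \<le> real (d n) / (real n - 1)"
      using that by (auto simp: admissible_def)
    then show "0 < d n" by (cases "d n = 0") auto
  qed
  have p1_range: "p1 n \<in> {0..1}" for n
    using admissible_lower_coupling(1,2)[of n "d n"] by (auto simp: p1_def \<epsilon>_def q_def)
  have p2_range: "p2 n \<in> {0..1}" for n
  proof (cases "?ok n")
    case True
    note compl = admissible_complement[OF True]
    have "0 \<le> (1 - 2 * \<epsilon> n) * (1 - q n)" "(1 - 2 * \<epsilon> n) * (1 - q n) \<le> 1"
      using admissible_lower_coupling(1,2)[OF compl(1)] unfolding compl(2) \<epsilon>_def q_def by auto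
    then show ?thesis using True by (simp add: p2_def)
  qed (simp add: p2_def)
  have p1_eq: "p1 n = (1 - \<epsilon>1 n) * (real (d n) / real n)" for n
    using ok[of n] by (auto simp: p1_def \<epsilon>1_def q_def)
  have p2_eq: "p2 n = (1 + \<epsilon>2 n) * (real (d n) / real n)" for n
    using ok[of n] by (cases "?ok n") (auto simp: \<epsilon>2_def p2_def)
  have ev: "\<forall>\<^sub>F n in sequentially. ?ok n \<and> real n / sqrt (ln (real n)) \<le> real (d n)"
    by (rule eventually_admissible[OF assms])
  have \<epsilon>1_lim: "\<epsilon>1 \<longlonglongrightarrow> 0"
  proof (rule Lim_transform_eventually)
    show "(\<lambda>n. 1 - (1 - 2 * (1 / ln (real n))) * (real n / (real n - 1))) \<longlonglongrightarrow> 0" by real_asymp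
    show "\<forall>\<^sub>F n in sequentially. 1 - (1 - 2 * (1 / ln (real n))) * (real n / (real n - 1)) = \<epsilon>1 n"
      using ev by eventually_elim (auto simp: \<epsilon>1_def \<epsilon>_def)
  qed
  have \<epsilon>2_lim: "\<epsilon>2 \<longlonglongrightarrow> 0"
  proof (rule tendsto_sandwich)
    \<comment> \<open>The relative error of \<open>p2\<close> is \<open>n / (n - 1) - 1\<close> plus
      a term of at most \<open>2 * \<epsilon> n * (n / d n)\<close>. Since
      \<open>n / d n \<le> sqrt (ln n)\<close>, this term is \<open>O(1 / sqrt (ln n))\<close>; here
      the assumed growth of \<open>d\<close> enters.\<close>
    have bounds: "0 \<le> \<epsilon>2 n \<and> \<epsilon>2 n \<le> real n / (real n - 1) - 1 + 2 / ln (real n) * sqrt (ln (real n))"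
      if n: "?ok n" "real n / sqrt (ln (real n)) \<le> real (d n)" for n
    proof -
      have l: "ln (real n) \<ge> 2" "\<epsilon> n \<le> q n" "\<epsilon> n \<le> 1 - q n" using n(1) by (auto simp: admissible_def \<epsilon>_def q_def)
      have \<epsilon>: "0 < \<epsilon> n" using l by (simp add: \<epsilon>_def)
      have nd: "real n / real (d n) > 0" using ok[OF n(1)] by simp
      have "real n \<le> real (d n) * sqrt (ln (real n))"
        using n(2) l by (simp add: divide_le_eq)
      then have nd2: "real n / real (d n) \<le> sqrt (ln (real n))"
        using ok[OF n(1)] by (simp add: divide_le_eq mult.commute)
      have "q n * (real n / real (d n)) = real n / (real n - 1)"
        using ok[OF n(1)] by (simp add: q_def)
      then have eq: "\<epsilon>2 n = real n / (real n - 1) - 1 + 2 * \<epsilon> n * (1 - q n) * (real n / real (d n))"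
        using n(1) by (simp add: \<epsilon>2_def p2_def algebra_simps)
      have "0 \<le> 2 * \<epsilon> n * (1 - q n) * (real n / real (d n))"
        using \<epsilon> l nd by (intro mult_nonneg_nonneg) auto
      moreover have "1 \<le> real n / (real n - 1)" using ok[OF n(1)] by simp
      moreover have "2 * \<epsilon> n * (1 - q n) * (real n / real (d n)) \<le> 2 * \<epsilon> n * 1 * sqrt (ln (real n))"
        using \<epsilon> l nd nd2 by (intro mult_mono mult_left_mono) auto
      ultimately show ?thesis unfolding eq by (simp add: \<epsilon>_def)
    qed
    show "\<forall>\<^sub>F n in sequentially. 0 \<le> \<epsilon>2 n"
      using ev by eventually_elim (use bounds in auto)
    show "\<forall>\<^sub>F n in sequentially. \<epsilon>2 n \<le> real n / (real n - 1) - 1 + 2 / ln (real n) * sqrt (ln (real n))"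
      using ev by eventually_elim (use bounds in auto)
    show "(\<lambda>n. real n / (real n - 1) - 1 + 2 / ln (real n) * sqrt (ln (real n))) \<longlonglongrightarrow> 0"
      by real_asymp
  qed simp
  have "\<exists>\<Gamma>. coupling3 \<Gamma> (binomial_graph n (p1 n)) (regular_graph n (d n)) (binomial_graph n (p2 n)) \<and>
      (?ok n \<longrightarrow> 1 - 2 * coupling_error n \<le> measure_pmf.prob \<Gamma> ?S)" for n
  proof (cases "?ok n")
    case True
    then show ?thesis using admissible_sandwich[OF True] by (simp add: p1_def p2_def \<epsilon>_def q_def)
  next
    case False
    then show ?thesis using coupling3_product by blast
  qed
  then have "\<exists>\<Gamma>. \<forall>n. coupling3 (\<Gamma> n) (binomial_graph n (p1 n)) (regular_graph n (d n)) (binomial_graph n (p2 n)) \<and>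
      (?ok n \<longrightarrow> 1 - 2 * coupling_error n \<le> measure_pmf.prob (\<Gamma> n) ?S)"
    by (intro choice allI)
  then obtain \<Gamma> where \<Gamma>: "\<And>n. coupling3 (\<Gamma> n) (binomial_graph n (p1 n)) (regular_graph n (d n))
      (binomial_graph n (p2 n))" "\<And>n. ?ok n \<Longrightarrow> 1 - 2 * coupling_error n \<le> measure_pmf.prob (\<Gamma> n) ?S"
    by blast
  have prob_lim: "(\<lambda>n. measure_pmf.prob (\<Gamma> n) ?S) \<longlonglongrightarrow> 1"
  proof (rule tendsto_sandwich)
    show "\<forall>\<^sub>F n in sequentially. 1 - 2 * coupling_error n \<le> measure_pmf.prob (\<Gamma> n) ?S"
      using ev by eventually_elim (use \<Gamma>(2) in auto)
    show "(\<lambda>n. 1 - 2 * coupling_error n) \<longlonglongrightarrow> 1"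
      using tendsto_diff[OF tendsto_const tendsto_mult_right_zero[OF coupling_error_tendsto_0, of 2], of 1]
      by simp
  qed auto
  show ?thesis
    using p1_range p2_range p1_eq p2_eq \<epsilon>1_lim \<epsilon>2_lim \<Gamma>(1) prob_lim by blast
qed

end
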